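(* Let $\rho,\delta\in(0,1)$ and consider a sequence of triples of integers $(k_n,n,N_n)$, indexed by $n$, with $k_n<n<N_n$, $k_n/n\to\rho$ and $n/N_n\to\delta$ as $n\to\infty$. Write $k=k_n$, $N=N_n$. For each $n$ let $A$ be a random $n\times N$ matrix whose nullspace is an orthant-symmetric and generic random subspace. Let $H^N=[0,1]^N$ and $\rho_W(\delta;H^N):=\max(0,2-\delta^{-1})$. Then $$\lim_{n\to\infty}\frac{\mathcal{E}f_k(AH^N)}{f_k(H^N)}=\begin{cases}1,&\rho<\rho_W(\delta;H^N),\\ 0,&\rho>\rho_W(\delta;H^N).\end{cases}$$
   Context: For a polyhedron $Q$, $f_k(Q)$ denotes the number of $k$-dimensional faces of $Q$; $AQ$ is the image of $Q$ under $A$; $\mathcal{E}$ denotes expectation. A random $(N-n)\times N$ matrix $B$ is orthant-symmetric if for each diagonal matrix $S$ with diagonal in $\{-1,1\}^N$ and every measurable set $\Omega$, $\mathrm{Prob}\{BS\in\Omega\}=\mathrm{Prob}\{B\in\Omega\}$. Let $V_B$ be the linear span of the rows of $B$. If $B$ is orthant-symmetric, $V_B$ is called an orthant-symmetric random subspace. If every subset of $N-n$ columns of $B$ is almost surely linearly independent, $V_B$ is called a generic random subspace. A random $n\times N$ matrix $A$ has an orthant-symmetric and generic nullspace if its nullspace $\mathcal{N}(A)$ equals $V_B$ for a random matrix $B$ having both properties. *)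

theory Defs
  imports "HOL-Probability.Probability" "HOL-Library.Function_Algebras"
begin

(* The dimensions n and N vary with the sequence index, so they cannot be carried by types.
   R^N is rendered as the space of all x :: nat => real with x i = 0 for i >= N; the pointwise
   real vector space structure on functions makes the library notions span, independent,
   affine hull and face_of available there.  Indices start at 0. *)

instantiation "fun" :: (type, real_vector) real_vector
begin

definition scaleR_fun_def: "c *\<^sub>R f = (\<lambda>x. c *\<^sub>R f x)"

instance
  by standard (simp_all add: scaleR_fun_def fun_eq_iff scaleR_add_right scaleR_add_left)

end

(* aff_dim is restricted to euclidean_space; this is what aff_dim S = int k unfolds to. *)
definition has_aff_dim :: "'a::real_vector set \<Rightarrow> nat \<Rightarrow> bool" where
  "has_aff_dim S k \<longleftrightarrow>
     (\<exists>B. affine hull B = affine hull S \<and> \<not> affine_dependent B \<and> card B = k + 1)"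

definition num_faces :: "nat \<Rightarrow> 'a::real_vector set \<Rightarrow> nat" where
  "num_faces k Q = card {F. F face_of Q \<and> has_aff_dim F k}"

definition hypercube :: "nat \<Rightarrow> (nat \<Rightarrow> real) set" where
  "hypercube N = {x. (\<forall>i<N. 0 \<le> x i \<and> x i \<le> 1) \<and> (\<forall>i\<ge>N. x i = 0)}"

(* A real m x N matrix is a function on nat * nat of which only the entries in
   {..<m} * {..<N} matter; a random one is measurable into the Borel sets of R^(m x N). *)
type_synonym rmat = "nat \<times> nat \<Rightarrow> real"

definition mat_borel :: "nat \<Rightarrow> nat \<Rightarrow> rmat measure" where
  "mat_borel m N = PiM ({..<m} \<times> {..<N}) (\<lambda>_. borel)"

definition mat_apply :: "nat \<Rightarrow> nat \<Rightarrow> rmat \<Rightarrow> (nat \<Rightarrow> real) \<Rightarrow> (nat \<Rightarrow> real)" where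
  "mat_apply m N A x = (\<lambda>i. if i < m then \<Sum>j<N. A (i, j) * x j else 0)"

definition nullspace :: "nat \<Rightarrow> nat \<Rightarrow> rmat \<Rightarrow> (nat \<Rightarrow> real) set" where
  "nullspace m N A = {x. (\<forall>j\<ge>N. x j = 0) \<and> mat_apply m N A x = (\<lambda>_. 0)}"

definition row_vec :: "nat \<Rightarrow> rmat \<Rightarrow> nat \<Rightarrow> (nat \<Rightarrow> real)" where
  "row_vec N B i = (\<lambda>j. if j < N then B (i, j) else 0)"

definition col_vec :: "nat \<Rightarrow> rmat \<Rightarrow> nat \<Rightarrow> (nat \<Rightarrow> real)" where
  "col_vec m B j = (\<lambda>i. if i < m then B (i, j) else 0)"

definition row_span :: "nat \<Rightarrow> nat \<Rightarrow> rmat \<Rightarrow> (nat \<Rightarrow> real) set" where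
  "row_span m N B = span (row_vec N B ` {..<m})"

(* The product B S with the diagonal matrix S = diag(s 0, ..., s (N - 1)). *)
definition times_diag :: "nat \<Rightarrow> nat \<Rightarrow> rmat \<Rightarrow> (nat \<Rightarrow> real) \<Rightarrow> rmat" where
  "times_diag m N B s = restrict (\<lambda>(i, j). B (i, j) * s j) ({..<m} \<times> {..<N})"

definition orthant_symmetric ::
    "'w measure \<Rightarrow> nat \<Rightarrow> nat \<Rightarrow> ('w \<Rightarrow> rmat) \<Rightarrow> bool" where
  "orthant_symmetric M m N B \<longleftrightarrow>
     (\<forall>s. (\<forall>j<N. s j \<in> {-1, 1}) \<longrightarrow>
       (\<forall>\<Omega> \<in> sets (mat_borel m N).
          measure M {\<omega> \<in> space M. times_diag m N (B \<omega>) s \<in> \<Omega>} =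
          measure M {\<omega> \<in> space M. B \<omega> \<in> \<Omega>}))"

(* Linear independence of the columns indexed by J as a family: equal columns are dependent. *)
definition generic_matrix ::
    "'w measure \<Rightarrow> nat \<Rightarrow> nat \<Rightarrow> ('w \<Rightarrow> rmat) \<Rightarrow> bool" where
  "generic_matrix M m N B \<longleftrightarrow>
     (\<forall>J \<subseteq> {..<N}. card J = m \<longrightarrow>
       (AE \<omega> in M. inj_on (col_vec m (B \<omega>)) J \<and> independent (col_vec m (B \<omega>) ` J)))"

definition orthant_symmetric_generic_nullspace ::
    "'w measure \<Rightarrow> nat \<Rightarrow> nat \<Rightarrow> ('w \<Rightarrow> rmat) \<Rightarrow> bool" where
  "orthant_symmetric_generic_nullspace M n N A \<longleftrightarrow>
     (\<exists>B. B \<in> measurable M (mat_borel (N - n) N)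
        \<and> orthant_symmetric M (N - n) N B
        \<and> generic_matrix M (N - n) N B
        \<and> (AE \<omega> in M. nullspace n N (A \<omega>) = row_span (N - n) N (B \<omega>)))"

definition rho_W_cube :: "real \<Rightarrow> real" where
  "rho_W_cube \<delta> = max 0 (2 - 1 / \<delta>)"

end

(* Almost surely the number of k-faces of A H^N is a constant. A k-face of the cube is given by
   the set J of the N - k fixed coordinates and the subset P of those fixed at 1. It survives the
   projection iff no nonzero vector of the nullspace W points from it into the cube, i.e. is
   nonpositive on P and nonnegative on J - P. As W is an (N-n)-dimensional space in general
   position, the number of P spoiled by some such vector is the number of cells that N - k generic
   hyperplanes through the origin cut out of R^(N-n), which by Schlaefli is 2 (C(N-k-1,0) + ... +
   C(N-k-1,N-n-1)). Hence the ratio is 1 - Prob{Bin(N-k-1, 1/2) < N-n}, and by Chebyshev its limit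
   depends on whether N - n lies below or above (N-k)/2, i.e. on whether k/n < 2 - N/n or k/n > 2
   - N/n. *)

theory Submission
  imports Defs
begin

section \<open>Linear images and affine dimension\<close>

text \<open>A face of the image pulls back to a face of the cube, but that face could have larger
  dimension. This is excluded once the matrix kills no nonzero vector with at most k + 1 nonzero
  coordinates: as k + 1 <= n, such a vector vanishes in at least N - n coordinates, and the
  nullspace is in general position. Survival of a face is governed by weak inequalities, whereas
  cells correspond to strict sign patterns. In general position the two agree, because a weak
  pattern can be perturbed inside W to a strict one. The hyperplanes are w j = 0 for j in J, and
  deletion and restriction of one of them turns the cell count into Pascal's rule. General position
  is therefore stated through values at coordinates instead of dimensions, a form inherited by
  subsets of J and by the sections w j = 0. Dividing twice a binomial sum by the 2^(N-k) sets P
  leaves the denominator 2^(N-k-1). After division by n, N - n tends to 1/\<delta> - 1 and (N-k)/2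
  to (1/\<delta> - \<rho>)/2; these limits coincide exactly at \<rho> = 2 - 1/\<delta>.\<close>

lemma scaleR_fun_apply [simp]: "(c *\<^sub>R f) x = c *\<^sub>R f x"
  by (simp add: scaleR_fun_def)

lemma sum_fun_apply: "(\<Sum>i\<in>I. f i) x = (\<Sum>i\<in>I. f i x)"
  for f :: "'i \<Rightarrow> 'a \<Rightarrow> 'b::comm_monoid_add"
  by (induction I rule: infinite_finite_induct) auto

definition unit_vec :: "nat \<Rightarrow> nat \<Rightarrow> real" where
  "unit_vec i = (\<lambda>j. of_bool (j = i))"

lemma unit_vec_expansion:
  assumes "finite I" "\<And>j. j \<notin> I \<Longrightarrow> x j = 0"
  shows "x = (\<Sum>i\<in>I. x i *\<^sub>R unit_vec i)"
proof
  fix j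
  have "(\<Sum>i\<in>I. x i *\<^sub>R unit_vec i) j = (\<Sum>i\<in>I. if i = j then x j else 0)"
    unfolding sum_fun_apply by (intro sum.cong) (auto simp: unit_vec_def)
  then show "x j = (\<Sum>i\<in>I. x i *\<^sub>R unit_vec i) j"
    using assms by (auto simp: sum.delta)
qed

lemma inj_unit_vec: "inj unit_vec"
proof
  fix i j assume "unit_vec i = unit_vec j"
  then have "unit_vec i i = unit_vec j i" by simp
  then show "i = j" by (simp add: unit_vec_def split: if_splits)
qed

text \<open>Injectivity of \<open>L\<close> on vectors supported in \<open>I\<close> becomes
  independence of the columns indexed by \<open>I\<close>. The claim \<open>inj_on\<close> is
  separate because independence of the image set alone would not notice repeated columns.\<close>

lemma independent_image_unit_vec:
  fixes L :: "(nat \<Rightarrow> real) \<Rightarrow> 'b::real_vector"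
  assumes L: "linear L" and fin: "finite I"
    and ker: "\<And>z. (\<And>j. j \<notin> I \<Longrightarrow> z j = 0) \<Longrightarrow> L z = 0 \<Longrightarrow> z = 0"
  shows "inj_on (\<lambda>i. L (unit_vec i)) I" and "independent ((\<lambda>i. L (unit_vec i)) ` I)"
proof -
  show inj: "inj_on (\<lambda>i. L (unit_vec i)) I"
  proof
    fix i j assume ij: "i \<in> I" "j \<in> I" "L (unit_vec i) = L (unit_vec j)"
    have "unit_vec i - unit_vec j = 0"
      using ij by (intro ker) (auto simp: unit_vec_def linear_diff[OF L])
    then show "i = j" using inj_unit_vec by (auto dest: injD)
  qed
  show "independent ((\<lambda>i. L (unit_vec i)) ` I)"
  proof (rule independent_if_scalars_zero)
    fix f x
    assume s: "(\<Sum>x\<in>(\<lambda>i. L (unit_vec i)) ` I. f x *\<^sub>R x) = 0"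
      and x: "x \<in> (\<lambda>i. L (unit_vec i)) ` I"
    define z where "z = (\<Sum>i\<in>I. f (L (unit_vec i)) *\<^sub>R unit_vec i)"
    have zj: "z j = (if j \<in> I then f (L (unit_vec j)) else 0)" for j
    proof -
      have "z j = (\<Sum>i\<in>I. if i = j then f (L (unit_vec j)) else 0)"
        unfolding z_def sum_fun_apply by (intro sum.cong) (auto simp: unit_vec_def)
      then show ?thesis using fin by (auto simp: sum.delta)
    qed
    have "L z = (\<Sum>i\<in>I. f (L (unit_vec i)) *\<^sub>R L (unit_vec i))"
      by (simp add: z_def linear_sum[OF L] linear_scale[OF L])
    also have "\<dots> = 0" using s by (simp add: sum.reindex[OF inj])
    finally have "z = 0" using zj by (intro ker) auto
    then have "z j = 0" for j by simp
    moreover obtain i where "i \<in> I" "x = L (unit_vec i)" using x by blast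
    ultimately show "f x = 0" using zj[of i] by metis
  qed (use fin in auto)
qed

text \<open>Translating by a point of \<open>S\<close> replaces affine bases by linear ones, so that
  dimension bounds for spans become available.\<close>

lemma has_aff_dim_iff:
  assumes "a \<in> S"
  shows "has_aff_dim S k \<longleftrightarrow>
    (\<exists>B. independent B \<and> finite B \<and> card B = k \<and> span B = span ((\<lambda>x. x - a) ` S))"
    (is "_ \<longleftrightarrow> ?R")
proof
  have hull: "affine hull S = (\<lambda>x. a + x) ` span ((\<lambda>x. x - a) ` S)"
    using affine_hull_span_gen[of a S] hull_inc[OF assms] by (simp add: add.commute)
  {
    assume "has_aff_dim S k"
    then obtain B where B: "affine hull B = affine hull S" "\<not> affine_dependent B" "card B = k + 1"
      unfolding has_aff_dim_def by auto
    then have "finite B" "B \<noteq> {}" by (auto intro: card_ge_0_finite)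
    then obtain b where b: "b \<in> B" by auto
    let ?C = "(\<lambda>x. -b + x) ` (B - {b})"
    have "affine hull B = (\<lambda>x. b + x) ` span ?C" using affine_hull_span2[OF b] .
    with B hull have eq: "(\<lambda>x. b + x) ` span ?C = (\<lambda>x. a + x) ` span ((\<lambda>x. x - a) ` S)"
      (is "_ ` ?V = _ ` ?U") by simp
    have "a \<in> (\<lambda>x. a + x) ` ?U" by (auto simp: image_iff intro: exI[of _ 0] span_zero)
    then have "a \<in> (\<lambda>x. b + x) ` ?V" using eq by simp
    then have ab: "a - b \<in> ?V" by auto
    \<comment> \<open>Two translates of subspaces coincide, and the difference \<open>a - b\<close>
      of the base points lies in \<open>?V\<close>; hence the subspaces coincide.\<close>
    have "?V = ?U"
    proof (intro set_eqI iffI)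
      fix x assume "x \<in> ?V"
      then have "x + (a - b) \<in> ?V" using ab by (rule span_add)
      then have "b + (x + (a - b)) \<in> (\<lambda>x. b + x) ` ?V" by (rule imageI)
      then show "x \<in> ?U" unfolding eq by auto
    next
      fix x assume "x \<in> ?U"
      then have "a + x \<in> (\<lambda>x. b + x) ` ?V" unfolding eq by auto
      then have "a + x - b \<in> ?V" by auto
      from span_diff[OF this ab] show "x \<in> ?V" by simp
    qed
    moreover have "independent ?C" using B(2) affine_dependent_iff_dependent2[OF b] by simp
    moreover have "card ?C = k" using B(3) b \<open>finite B\<close> by (simp add: card_image)
    ultimately show ?R using \<open>finite B\<close> by blast
  }
  assume ?R
  then obtain B where B: "independent B" "finite B" "card B = k"
    "span B = span ((\<lambda>x. x - a) ` S)" by auto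
  have 0: "0 \<notin> B" using B(1) dependent_zero by auto
  let ?C = "(\<lambda>x. a + x) ` B"
  have im: "(\<lambda>x. -a + x) ` ?C = B" by (simp add: image_image)
  have a: "a \<notin> ?C" using 0 by auto
  have "affine hull (insert a ?C) = affine hull S"
    using affine_hull_insert_span_gen[of a ?C] unfolding im hull B(4) .
  moreover have "\<not> affine_dependent (insert a ?C)"
    using affine_dependent_iff_dependent[OF a] B(1) unfolding im by simp
  moreover have "card (insert a ?C) = k + 1"
    using a B by (simp add: card_image)
  ultimately show "has_aff_dim S k" unfolding has_aff_dim_def by blast
qed

lemma face_of_linear_preimage:
  assumes L: "linear L" and H: "convex H" and G: "G face_of (L ` H)"
  shows "(H \<inter> L -` G) face_of H" and "L ` (H \<inter> L -` G) = G"
proof -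
  show "L ` (H \<inter> L -` G) = G" using face_of_imp_subset[OF G] by blast
  have cG: "convex G" using G face_of_imp_convex by blast
  show "(H \<inter> L -` G) face_of H"
    unfolding face_of_def
  proof (intro conjI ballI impI)
    show "convex (H \<inter> L -` G)"
      using H cG L by (intro convex_Int convex_linear_vimage) auto
  next
    fix a b x assume ab: "a \<in> H" "b \<in> H" and x: "x \<in> H \<inter> L -` G" and seg: "x \<in> open_segment a b"
    obtain u where u: "0 < u" "u < 1" "x = (1 - u) *\<^sub>R a + u *\<^sub>R b"
      using seg by (auto simp: in_segment)
    have Lx: "L x = (1 - u) *\<^sub>R L a + u *\<^sub>R L b"
      by (simp add: u linear_add[OF L] linear_scale[OF L])
    have "L a \<in> G \<and> L b \<in> G"
    \<comment> \<open>If the endpoints have the same image, the open segment between the images is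
      empty and the face property gives nothing; but then both images equal
      \<open>L x\<close>.\<close>
    proof (cases "L a = L b")
      case True
      then have "L x = L a" using Lx by (simp add: scaleR_left_distrib[symmetric])
      then show ?thesis using True x by auto
    next
      case False
      then have "L x \<in> open_segment (L a) (L b)" using u Lx by (auto simp: in_segment)
      then show ?thesis using G ab x by (auto simp: face_of_def)
    qed
    then show "a \<in> H \<inter> L -` G" "b \<in> H \<inter> L -` G" using ab by auto
  qed auto
qed

section \<open>Sign patterns of a subspace in general position\<close>

text \<open>These are the cells cut out of \<open>W\<close> by the hyperplanes
  \<open>w j = 0\<close> for \<open>j\<close> in \<open>J\<close>, each named by its set of negative
  coordinates.\<close>

definition sign_patterns :: "('a \<Rightarrow> real) set \<Rightarrow> 'a set \<Rightarrow> 'a set set" where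
  "sign_patterns W J = {P. P \<subseteq> J \<and> (\<exists>w\<in>W. (\<forall>j\<in>P. w j < 0) \<and> (\<forall>j\<in>J - P. 0 < w j))}"

definition weak_sign_patterns :: "('a \<Rightarrow> real) set \<Rightarrow> 'a set \<Rightarrow> 'a set set" where
  "weak_sign_patterns W J =
     {P. P \<subseteq> J \<and> (\<exists>w\<in>W. w \<noteq> 0 \<and> (\<forall>j\<in>P. w j \<le> 0) \<and> (\<forall>j\<in>J - P. 0 \<le> w j))}"

text \<open>If \<open>J\<close> is finite with at least \<open>m\<close> elements, this says that
  any \<open>m\<close> coordinates from \<open>J\<close> form a coordinate system on
  \<open>W\<close>, so that \<open>W\<close> has dimension \<open>m\<close>. For smaller
  \<open>J\<close> only the interpolation clause has content, which lets the induction over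
  \<open>J\<close> run down to one element with \<open>m\<close> unchanged.\<close>

definition general_position :: "('a \<Rightarrow> real) set \<Rightarrow> 'a set \<Rightarrow> nat \<Rightarrow> bool" where
  "general_position W J m \<longleftrightarrow> subspace W \<and>
     (\<forall>T\<subseteq>J. m \<le> card T \<longrightarrow> (\<forall>w\<in>W. (\<forall>j\<in>T. w j = 0) \<longrightarrow> w = 0)) \<and>
     (\<forall>T\<subseteq>J. card T \<le> m \<longrightarrow> (\<forall>v. \<exists>w\<in>W. \<forall>j\<in>T. w j = v j))"

lemma general_position_subspace: "general_position W J m \<Longrightarrow> subspace W"
  by (simp add: general_position_def)

lemma general_position_eq_0:
  assumes "general_position W J m" "T \<subseteq> J" "m \<le> card T" "w \<in> W" "\<And>j. j \<in> T \<Longrightarrow> w j = 0"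
  shows "w = 0"
proof -
  have "\<forall>w\<in>W. (\<forall>j\<in>T. w j = 0) \<longrightarrow> w = 0"
    using assms(1,2,3) unfolding general_position_def by blast
  then show ?thesis using assms(4,5) by blast
qed

lemma general_position_interpolate:
  assumes "general_position W J m" "T \<subseteq> J" "card T \<le> m"
  obtains w where "w \<in> W" "\<And>j. j \<in> T \<Longrightarrow> w j = v j"
proof -
  have "\<forall>v. \<exists>w\<in>W. \<forall>j\<in>T. w j = v j"
    using assms unfolding general_position_def by blast
  then show ?thesis using that by blast
qed

lemma sign_patterns_0: "J \<noteq> {} \<Longrightarrow> sign_patterns {0} J = {}"
  by (fastforce simp: sign_patterns_def)

lemma general_position_subset:
  "general_position W J m \<Longrightarrow> I \<subseteq> J \<Longrightarrow> general_position W I m"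
  unfolding general_position_def by (meson order_trans)

text \<open>Vanishing at \<open>j\<close> counts as one more prescribed coordinate: both clauses for
  \<open>T\<close> follow from those for \<open>insert j T\<close>, one dimension higher.\<close>

lemma general_position_section:
  assumes W: "general_position W (insert j J) (Suc m)" and "finite J" "j \<notin> J"
  shows "general_position {w \<in> W. w j = 0} J m"
  unfolding general_position_def
proof (intro conjI allI impI ballI)
  have s: "subspace W" using W by (simp add: general_position_def)
  then show "subspace {w \<in> W. w j = 0}" by (auto simp: subspace_def)
  fix T assume T: "T \<subseteq> J"
  have c: "card (insert j T) = Suc (card T)"
    using T assms by (meson card_insert_disjoint finite_subset in_mono)
  have sub: "insert j T \<subseteq> insert j J" using T by auto
  {
    fix w assume "m \<le> card T" "w \<in> {w \<in> W. w j = 0}" "\<forall>i\<in>T. w i = 0"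
    then show "w = 0"
      using general_position_eq_0[OF W sub] c by auto
  }
  {
    fix v :: "'a \<Rightarrow> real" assume "card T \<le> m"
    then obtain w where "w \<in> W" "\<forall>i\<in>insert j T. w i = (v(j := 0)) i"
      using general_position_interpolate[OF W sub, of "v(j := 0)"] c by (metis Suc_le_mono)
    then show "\<exists>w\<in>{w \<in> W. w j = 0}. \<forall>i\<in>T. w i = v i"
      using T \<open>j \<notin> J\<close> by (intro bexI[of _ w]) auto
  }
qed

text \<open>Strict inequalities at finitely many coordinates survive a small step, so
  \<open>u\<close> can set the signs where \<open>w\<close> vanishes without disturbing the
  others.\<close>

lemma small_perturbation:
  fixes w u :: "'a \<Rightarrow> real"
  assumes "finite J"
  obtains t where "t > 0" "\<forall>j\<in>J. w j > 0 \<longrightarrow> w j + t * u j > 0"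
    "\<forall>j\<in>J. w j < 0 \<longrightarrow> w j + t * u j < 0"
proof -
  have "\<forall>\<^sub>F t in at_right 0. \<forall>j\<in>J. (w j > 0 \<longrightarrow> w j + t * u j > 0) \<and> (w j < 0 \<longrightarrow> w j + t * u j < 0)"
  proof (intro eventually_ball_finite ballI assms eventually_conj)
    fix j
    have l: "((\<lambda>t. w j + t * u j) \<longlongrightarrow> w j + 0 * u j) (at_right 0)"
      by (intro tendsto_intros)
    show "\<forall>\<^sub>F t in at_right 0. w j > 0 \<longrightarrow> w j + t * u j > 0"
      using order_tendstoD(1)[OF l, of 0] by (cases "w j > 0") auto
    show "\<forall>\<^sub>F t in at_right 0. w j < 0 \<longrightarrow> w j + t * u j < 0"
      using order_tendstoD(2)[OF l, of 0] by (cases "w j < 0") auto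
  qed
  moreover have "\<forall>\<^sub>F t in at_right (0::real). t > 0" by (simp add: eventually_at_right_less)
  ultimately have "\<forall>\<^sub>F t in at_right 0. t > 0 \<and>
    (\<forall>j\<in>J. (w j > 0 \<longrightarrow> w j + t * u j > 0) \<and> (w j < 0 \<longrightarrow> w j + t * u j < 0))"
    by eventually_elim auto
  from eventually_happens'[OF trivial_limit_at_right_real this] obtain t where "t > 0 \<and>
    (\<forall>j\<in>J. (w j > 0 \<longrightarrow> w j + t * u j > 0) \<and> (w j < 0 \<longrightarrow> w j + t * u j < 0))"
    by (elim exE)
  then show ?thesis using that by blast
qed

text \<open>A nonzero \<open>w\<close> in \<open>W\<close> vanishes at fewer than \<open>m\<close>
  coordinates of \<open>J\<close>, so some \<open>u\<close> in \<open>W\<close> takes the desired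
  signs at all of them; a small step along \<open>u\<close> makes the weak pattern strict.\<close>

lemma weak_sign_patterns_eq:
  assumes W: "general_position W J m" and J: "finite J" "J \<noteq> {}" "m \<le> card J"
  shows "weak_sign_patterns W J = sign_patterns W J"
proof (intro equalityI subsetI)
  fix P assume "P \<in> sign_patterns W J"
  then obtain w where P: "P \<subseteq> J" and w: "w \<in> W" "\<forall>j\<in>P. w j < 0" "\<forall>j\<in>J - P. 0 < w j"
    unfolding sign_patterns_def by auto
  moreover have "w \<noteq> 0"
  proof
    assume "w = 0"
    with w P J(2) show False by fastforce
  qed
  ultimately show "P \<in> weak_sign_patterns W J"
    unfolding weak_sign_patterns_def by (auto intro!: bexI[of _ w] simp: less_imp_le)
next
  fix P assume "P \<in> weak_sign_patterns W J"
  then obtain w where P: "P \<subseteq> J" and w: "w \<in> W" "w \<noteq> 0" "\<forall>j\<in>P. w j \<le> 0" "\<forall>j\<in>J - P. 0 \<le> w j"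
    unfolding weak_sign_patterns_def by auto
  define Z where "Z = {j\<in>J. w j = 0}"
  have "Z \<subseteq> J" by (auto simp: Z_def)
  have "\<not> m \<le> card Z"
  proof
    assume "m \<le> card Z"
    then have "w = 0"
      by (rule general_position_eq_0[OF W \<open>Z \<subseteq> J\<close> _ w(1)]) (simp add: Z_def)
    with w(2) show False ..
  qed
  then have "card Z \<le> m" by simp
  then obtain u where u: "u \<in> W" "\<And>j. j \<in> Z \<Longrightarrow> u j = (if j \<in> P then -1 else 1)"
    using general_position_interpolate[OF W \<open>Z \<subseteq> J\<close>, of "\<lambda>j. if j \<in> P then -1 else 1"] by blast
  obtain t where t: "t > 0" "\<forall>j\<in>J. w j > 0 \<longrightarrow> w j + t * u j > 0"
    "\<forall>j\<in>J. w j < 0 \<longrightarrow> w j + t * u j < 0" using small_perturbation[OF J(1), of w u] by blast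
  have "w + t *\<^sub>R u \<in> W"
    using W w(1) u(1) by (simp add: general_position_def subspace_add subspace_scale)
  moreover have "(w + t *\<^sub>R u) j < 0" if "j \<in> P" for j
    using that P w(3) t u(2) by (cases "w j = 0") (auto simp: Z_def less_le)
  moreover have "0 < (w + t *\<^sub>R u) j" if "j \<in> J - P" for j
    using that P w(4) t u(2) by (cases "w j = 0") (auto simp: Z_def less_le)
  ultimately show "P \<in> sign_patterns W J" using P unfolding sign_patterns_def by blast
qed

text \<open>Deletion and restriction: a pattern on \<open>J\<close> extends to both signs at \<open>j\<close> iff it is
  realised on the section \<open>w j = 0\<close>, and otherwise extends to exactly one sign.\<close>

lemma card_sign_patterns_insert:
  assumes W: "general_position W (insert j J) (Suc m)" and J: "finite J" "j \<notin> J"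
  shows "card (sign_patterns W (insert j J)) =
    card (sign_patterns W J) + card (sign_patterns {w \<in> W. w j = 0} J)"
proof -
  have sW: "subspace W" using W by (rule general_position_subspace)
  obtain u where u: "u \<in> W" "u j = 1"
    using general_position_interpolate[OF W, of "{j}" "\<lambda>_. 1"] by auto
  define S where "S = sign_patterns W (insert j J)"
  \<comment> \<open>\<open>A\<close> collects the patterns on \<open>J\<close> that extend with a
    positive value at \<open>j\<close>, \<open>B\<close> those that extend with a negative
    one.\<close>
  define A where "A = {P. P \<subseteq> J \<and> P \<in> S}"
  define B where "B = {P. P \<subseteq> J \<and> insert j P \<in> S}"
  have fA: "finite A" and fB: "finite B"
    using J(1) by (auto simp: A_def B_def)
  have "S = A \<union> insert j ` B"
  proof (intro set_eqI iffI)
    fix P assume P: "P \<in> S"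
    then have sub: "P \<subseteq> insert j J" by (auto simp: S_def sign_patterns_def)
    show "P \<in> A \<union> insert j ` B"
    proof (cases "j \<in> P")
      case True
      then have "insert j (P - {j}) = P" by auto
      then have "P - {j} \<in> B" using P sub by (auto simp: B_def)
      then show ?thesis using True by (auto intro!: image_eqI[of _ _ "P - {j}"])
    qed (use P sub in \<open>auto simp: A_def\<close>)
  qed (auto simp: A_def B_def)
  moreover have "A \<inter> insert j ` B = {}" using J(2) by (auto simp: A_def)
  moreover have "inj_on (insert j) B"
    using J(2) unfolding inj_on_def B_def by (metis (no_types, lifting) insert_ident mem_Collect_eq subsetD)
  ultimately have "card S = card A + card B"
    using fA fB by (simp add: card_Un_disjoint card_image)
  also have "\<dots> = card (A \<union> B) + card (A \<inter> B)"
    using fA fB by (rule card_Un_Int)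
  also have "A \<union> B = sign_patterns W J"
  proof (intro set_eqI iffI)
    fix P assume "P \<in> A \<union> B"
    then show "P \<in> sign_patterns W J"
    proof
      assume "P \<in> A"
      then show ?thesis by (auto simp: A_def S_def sign_patterns_def)
    next
      assume P: "P \<in> B"
      then have "insert j J - insert j P = J - P" using J(2) by (auto simp: B_def)
      then show ?thesis using P by (auto simp: B_def S_def sign_patterns_def)
    qed
  next
    fix P assume "P \<in> sign_patterns W J"
    then obtain w where w: "P \<subseteq> J" "w \<in> W" "\<forall>j\<in>P. w j < 0" "\<forall>j\<in>J - P. 0 < w j"
      unfolding sign_patterns_def by auto
    \<comment> \<open>If the witness lies on the hyperplane \<open>w j = 0\<close>, a small step
      along \<open>u\<close> takes it off without changing its signs on \<open>J\<close>.\<close>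
    obtain w' where w': "w' \<in> W" "\<forall>j\<in>P. w' j < 0" "\<forall>j\<in>J - P. 0 < w' j" "w' j \<noteq> 0"
    proof (cases "w j = 0")
      case True
      obtain t where t: "t > 0" "\<forall>j\<in>J. w j > 0 \<longrightarrow> w j + t * u j > 0"
        "\<forall>j\<in>J. w j < 0 \<longrightarrow> w j + t * u j < 0" using small_perturbation[OF J(1), of w u] by blast
      have "w + t *\<^sub>R u \<in> W" using sW w(2) u(1) by (simp add: subspace_add subspace_scale)
      then show ?thesis using that[of "w + t *\<^sub>R u"] t w True u(2) by auto
    qed (use w that in blast)
    show "P \<in> A \<union> B"
    proof (cases "w' j > 0")
      case True
      then have "P \<in> A" using w' w(1) by (auto simp: A_def S_def sign_patterns_def intro!: bexI[of _ w'])
      then show ?thesis ..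
    next
      case False
      then have "w' j < 0" using w'(4) by simp
      then have "P \<in> B" using w' w(1) by (auto simp: B_def S_def sign_patterns_def intro!: bexI[of _ w'])
      then show ?thesis ..
    qed
  qed
  also have "A \<inter> B = sign_patterns {w \<in> W. w j = 0} J"
  proof (intro set_eqI iffI)
    fix P assume P: "P \<in> A \<inter> B"
    then have PJ: "P \<subseteq> J" and jP: "j \<notin> P" using J(2) by (auto simp: A_def)
    from P obtain p where p: "p \<in> W" "\<forall>i\<in>P. p i < 0" "\<forall>i\<in>J - P. 0 < p i" "p j > 0"
      using jP by (auto simp: A_def S_def sign_patterns_def)
    from P obtain q where q: "q \<in> W" "\<forall>i\<in>P. q i < 0" "\<forall>i\<in>J - P. 0 < q i" "q j < 0"
      using J(2) by (auto simp: B_def S_def sign_patterns_def)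
    \<comment> \<open>The positive combination of \<open>p\<close> and \<open>q\<close> that cancels
      at \<open>j\<close>: both weights are positive, so the common signs on \<open>J\<close> are
      kept.\<close>
    define w where "w = (- q j) *\<^sub>R p + p j *\<^sub>R q"
    have "w \<in> W" unfolding w_def using sW p q by (intro subspace_add subspace_scale) auto
    moreover have "w j = 0" by (simp add: w_def)
    moreover have "w i < 0" if "i \<in> P" for i
    proof -
      have "(- q j) * p i < 0" "p j * q i < 0" using p q that by (simp_all add: mult_neg_neg mult_pos_neg)
      then show ?thesis by (simp add: w_def)
    qed
    moreover have "w i > 0" if "i \<in> J - P" for i
    proof -
      have "(- q j) * p i > 0" "p j * q i > 0" using p q that by (simp_all add: mult_neg_pos)
      then show ?thesis by (simp add: w_def)
    qed
    ultimately show "P \<in> sign_patterns {w \<in> W. w j = 0} J"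
      using PJ unfolding sign_patterns_def by blast
  next
    fix P assume "P \<in> sign_patterns {w \<in> W. w j = 0} J"
    then obtain w where w: "P \<subseteq> J" "w \<in> W" "w j = 0" "\<forall>j\<in>P. w j < 0" "\<forall>j\<in>J - P. 0 < w j"
      unfolding sign_patterns_def by auto
    \<comment> \<open>Small steps along \<open>u\<close> and along \<open>- u\<close> leave the
      hyperplane on either side and thus realise both signs at \<open>j\<close>.\<close>
    obtain t where t: "t > 0" "\<forall>j\<in>J. w j > 0 \<longrightarrow> w j + t * u j > 0"
      "\<forall>j\<in>J. w j < 0 \<longrightarrow> w j + t * u j < 0" using small_perturbation[OF J(1), of w u] by blast
    obtain s where s: "s > 0" "\<forall>j\<in>J. w j > 0 \<longrightarrow> w j + s * (- u) j > 0"
      "\<forall>j\<in>J. w j < 0 \<longrightarrow> w j + s * (- u) j < 0" using small_perturbation[OF J(1), of w "- u"] by blast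
    have "w + t *\<^sub>R u \<in> W" "w + s *\<^sub>R (- u) \<in> W"
      by (intro subspace_add subspace_scale subspace_neg sW w(2) u(1))+
    moreover have "\<forall>i\<in>P. (w + t *\<^sub>R u) i < 0" "\<forall>i\<in>insert j J - P. 0 < (w + t *\<^sub>R u) i"
      "\<forall>i\<in>insert j P. (w + s *\<^sub>R (- u)) i < 0" "\<forall>i\<in>J - P. 0 < (w + s *\<^sub>R (- u)) i"
      using w t s u(2) by auto
    moreover have "insert j J - insert j P = J - P" using J(2) by auto
    ultimately have "P \<in> S" "insert j P \<in> S"
      using w(1) unfolding S_def sign_patterns_def by (auto simp only: mem_Collect_eq)
    then show "P \<in> A \<inter> B" using w(1) by (simp add: A_def B_def)
  qed
  finally show ?thesis unfolding S_def .
qed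

lemma general_position_0_trivial:
  assumes "general_position W J 0"
  shows "W = {0}"
proof -
  have "\<forall>w\<in>W. w = 0" "0 \<in> W"
    using assms by (auto simp: general_position_def subspace_0)
  then show ?thesis by blast
qed

text \<open>Schlaefli's count. Deletion and restriction give the recursion, which is Pascal's rule
  summed over \<open>i < m\<close>. The factor 2 comes from a single hyperplane, which has two
  sides. The case \<open>m = 0\<close> stands apart because there is no section to pass to:
  \<open>W\<close> is trivial and has no strict pattern.\<close>

lemma card_sign_patterns:
  assumes "finite J" "J \<noteq> {}" "general_position W J m"
  shows "card (sign_patterns W J) = 2 * (\<Sum>i<m. (card J - 1) choose i)"
  using assms
proof (induction J arbitrary: W m rule: finite_ne_induct)
  case (singleton j)
  show ?case
  proof (cases m)
    case 0
    then show ?thesis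
      using general_position_0_trivial[of W "{j}"] singleton by (simp add: sign_patterns_0)
  next
    case (Suc m')
    have "\<exists>w\<in>W. w j = c" for c
      using general_position_interpolate[OF singleton, of "{j}" "\<lambda>_. c"] Suc by auto
    then have "\<exists>w\<in>W. w j > 0" "\<exists>w\<in>W. w j < 0"
      by (metis zero_less_one, metis neg_less_0_iff_less zero_less_one)
    then have "sign_patterns W {j} = {{}, {j}}" by (auto simp: sign_patterns_def)
    moreover have "(\<Sum>i<m. 0 choose i) = 1" unfolding Suc by (subst sum.lessThan_Suc_shift) simp
    ultimately show ?thesis by simp
  qed
next
  case (insert j J)
  show ?case
  proof (cases m)
    case 0
    then show ?thesis
      using general_position_0_trivial[of W "insert j J"] insert.prems by (simp add: sign_patterns_0)
  next
    case (Suc m')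
    obtain r where r: "card J = Suc r" using insert.hyps by (cases "card J") auto
    have 1: "card (sign_patterns W J) = 2 * (\<Sum>i<m. (card J - 1) choose i)"
      using insert.IH general_position_subset[OF insert.prems subset_insertI] .
    have 2: "card (sign_patterns {w \<in> W. w j = 0} J) = 2 * (\<Sum>i<m'. (card J - 1) choose i)"
      using insert.IH general_position_section[of W j J m'] insert.hyps insert.prems Suc by simp
    have "(\<Sum>i<m. Suc r choose i) = (\<Sum>i<m. r choose i) + (\<Sum>i<m'. r choose i)"
      unfolding Suc sum.lessThan_Suc_shift[of _ m'] by (simp add: sum.distrib)
    then show ?thesis
      using card_sign_patterns_insert[of W j J m'] insert Suc 1 2 r by simp
  qed
qed

section \<open>Faces of linear images of the cube\<close>

definition cube_face :: "nat \<Rightarrow> nat set \<Rightarrow> nat set \<Rightarrow> (nat \<Rightarrow> real) set" where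
  "cube_face N J P = {x \<in> hypercube N. \<forall>j\<in>J. x j = of_bool (j \<in> P)}"

lemma convex_hypercube: "convex (hypercube N)"
  unfolding convex_alt
proof (intro ballI allI impI)
  fix x y and u :: real assume xy: "x \<in> hypercube N" "y \<in> hypercube N" and u: "0 \<le> u \<and> u \<le> 1"
  have "(1 - u) * x i + u * y i \<le> 1" if "i < N" for i
    using xy u that by (intro convex_bound_le) (auto simp: hypercube_def)
  moreover have "0 \<le> (1 - u) * x i + u * y i" if "i < N" for i
    using xy u that by (auto simp: hypercube_def)
  ultimately show "(1 - u) *\<^sub>R x + u *\<^sub>R y \<in> hypercube N"
    using xy by (auto simp: hypercube_def)
qed

lemma convex_cube_face: "convex (cube_face N J P)"
  unfolding convex_alt
proof (intro ballI allI impI)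
  fix x y and u :: real
  assume xy: "x \<in> cube_face N J P" "y \<in> cube_face N J P" and u: "0 \<le> u \<and> u \<le> 1"
  have "(1 - u) *\<^sub>R x + u *\<^sub>R y \<in> hypercube N"
    using convex_hypercube xy u unfolding convex_alt cube_face_def by blast
  then show "(1 - u) *\<^sub>R x + u *\<^sub>R y \<in> cube_face N J P"
    using xy by (auto simp: cube_face_def algebra_simps)
qed

text \<open>A relatively interior point of the face. The value 1/2 tells free coordinates from fixed
  ones and leaves room to move by 1/2 either way.\<close>

definition cube_center :: "nat \<Rightarrow> nat set \<Rightarrow> nat set \<Rightarrow> nat \<Rightarrow> real" where
  "cube_center N J P = (\<lambda>j. if j \<in> J then of_bool (j \<in> P) else if j < N then 1/2 else 0)"

lemma cube_center_in_cube_face: "J \<subseteq> {..<N} \<Longrightarrow> cube_center N J P \<in> cube_face N J P"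
  by (auto simp: cube_center_def cube_face_def hypercube_def)

lemma cube_face_subset_imp:
  assumes "J \<subseteq> {..<N}" "J' \<subseteq> {..<N}" "cube_face N J P \<subseteq> cube_face N J' P'"
  shows "J' \<subseteq> J" "P \<inter> J' = P' \<inter> J'"
proof -
  have c: "cube_center N J P j = of_bool (j \<in> P')" if "j \<in> J'" for j
    using cube_center_in_cube_face[OF assms(1), of P] assms(3) that by (auto simp: cube_face_def)
  show J: "J' \<subseteq> J"
  proof
    fix j assume "j \<in> J'"
    then show "j \<in> J" using c[of j] assms(2)
      by (cases "j \<in> P'") (auto simp: cube_center_def split: if_splits)
  qed
  show "P \<inter> J' = P' \<inter> J'"
  proof (intro set_eqI)
    fix j show "j \<in> P \<inter> J' \<longleftrightarrow> j \<in> P' \<inter> J'"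
      using c[of j] J by (auto simp: cube_center_def split: if_splits)
  qed
qed

lemma cube_face_eq_iff:
  assumes "P \<subseteq> J" "J \<subseteq> {..<N}" "P' \<subseteq> J'" "J' \<subseteq> {..<N}"
  shows "cube_face N J P = cube_face N J' P' \<longleftrightarrow> J = J' \<and> P = P'"
proof
  assume eq: "cube_face N J P = cube_face N J' P'"
  have "J' \<subseteq> J" "P \<inter> J' = P' \<inter> J'"
    by (rule cube_face_subset_imp[OF assms(2,4) equalityD1[OF eq]])+
  moreover have "J \<subseteq> J'"
    by (rule cube_face_subset_imp[OF assms(4,2) equalityD2[OF eq]])
  ultimately show "J = J' \<and> P = P'" using assms(1,3) by auto
qed auto

text \<open>The segment from \<open>x\<close> to \<open>c\<close> can be prolonged beyond
  \<open>c\<close>: coordinates of \<open>c\<close> strictly inside the interval have room, the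
  others do not move because \<open>x\<close> agrees with \<open>c\<close> there. Then
  \<open>c\<close> lies strictly between two points of the cube, and a face containing
  \<open>c\<close> must contain \<open>x\<close>.\<close>

lemma extend_segment_in_hypercube:
  assumes c: "c \<in> hypercube N" and x: "x \<in> hypercube N"
    and eq: "\<And>j. j < N \<Longrightarrow> \<not> (0 < c j \<and> c j < 1) \<Longrightarrow> x j = c j"
  obtains t where "t > 0" "c + t *\<^sub>R (c - x) \<in> hypercube N"
proof -
  have "\<forall>\<^sub>F t in at_right 0. \<forall>j\<in>{..<N}. 0 \<le> c j + t * (c j - x j) \<and> c j + t * (c j - x j) \<le> 1"
  proof (intro eventually_ball_finite ballI finite_lessThan eventually_conj)
    fix j assume "j \<in> {..<N}"
    then have j: "j < N" by simp
    have l: "((\<lambda>t. c j + t * (c j - x j)) \<longlongrightarrow> c j + 0 * (c j - x j)) (at_right 0)"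
      by (intro tendsto_intros)
    show "\<forall>\<^sub>F t in at_right 0. 0 \<le> c j + t * (c j - x j)"
    proof (cases "0 < c j \<and> c j < 1")
      case True
      then have "\<forall>\<^sub>F t in at_right 0. 0 < c j + t * (c j - x j)"
        using order_tendstoD(1)[OF l, of 0] by simp
      then show ?thesis by eventually_elim simp
    next
      case False
      then have "x j = c j" using eq j by blast
      then show ?thesis using c j by (simp add: hypercube_def)
    qed
    show "\<forall>\<^sub>F t in at_right 0. c j + t * (c j - x j) \<le> 1"
    proof (cases "0 < c j \<and> c j < 1")
      case True
      then have "\<forall>\<^sub>F t in at_right 0. c j + t * (c j - x j) < 1"
        using order_tendstoD(2)[OF l, of 1] by simp
      then show ?thesis by eventually_elim simp
    next
      case False
      then have "x j = c j" using eq j by blast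
      then show ?thesis using c j by (simp add: hypercube_def)
    qed
  qed
  moreover have "\<forall>\<^sub>F t in at_right (0::real). t > 0" by (simp add: eventually_at_right_less)
  ultimately have "\<forall>\<^sub>F t in at_right 0. t > 0 \<and>
    (\<forall>j\<in>{..<N}. 0 \<le> c j + t * (c j - x j) \<and> c j + t * (c j - x j) \<le> 1)"
    by eventually_elim auto
  from eventually_happens'[OF trivial_limit_at_right_real this] obtain t where t: "t > 0"
    "\<forall>j\<in>{..<N}. 0 \<le> c j + t * (c j - x j) \<and> c j + t * (c j - x j) \<le> 1"
    by (elim exE conjE)
  then have "c + t *\<^sub>R (c - x) \<in> hypercube N" using c x by (auto simp: hypercube_def)
  then show ?thesis using that t by blast
qed

lemma extend_segment_imp_open_segment:
  fixes c x :: "'a::real_vector"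
  assumes "t > 0" "x \<noteq> c"
  shows "c \<in> open_segment x (c + t *\<^sub>R (c - x))"
proof -
  have ne: "x \<noteq> c + t *\<^sub>R (c - x)"
  proof
    assume "x = c + t *\<^sub>R (c - x)"
    then have "(1 + t) *\<^sub>R (c - x) = 0" by (simp add: algebra_simps)
    then show False using assms by simp
  qed
  \<comment> \<open>The coefficient of \<open>c\<close> must be \<open>u * (1 + t) = 1\<close>; that
    of \<open>x\<close> is then \<open>1 - u - u * t = 0\<close>.\<close>
  define u where "u = 1 / (1 + t)"
  have u: "0 < u" "u < 1" "u * (1 + t) = 1" using assms by (auto simp: u_def)
  have "(1 - u) *\<^sub>R x + u *\<^sub>R (c + t *\<^sub>R (c - x)) = (1 - u) *\<^sub>R x + ((u * (1 + t)) *\<^sub>R c - (u * (1 + t) - u) *\<^sub>R x)"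
    by (simp add: algebra_simps)
  also have "\<dots> = c" using u(3) by simp
  finally show ?thesis using ne u by (auto simp: in_segment intro!: exI[of _ u])
qed

text \<open>A face is recovered from one of its points with the largest number of coordinates
  strictly between 0 and 1: such a point is relatively interior.\<close>

lemma face_of_hypercube:
  assumes F: "F face_of hypercube N" "F \<noteq> {}"
  obtains J P where "P \<subseteq> J" "J \<subseteq> {..<N}" "F = cube_face N J P"
proof -
  define I where "I = (\<lambda>x::nat \<Rightarrow> real. {j. j < N \<and> 0 < x j \<and> x j < 1})"
  have FH: "F \<subseteq> hypercube N" using F(1) by (rule face_of_imp_subset)
  have bd: "card (I x) \<le> N" for x
    using card_mono[of "{..<N}" "I x"] by (auto simp: I_def)
  obtain c where c: "c \<in> F" "\<And>x. x \<in> F \<Longrightarrow> card (I x) \<le> card (I c)"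
  proof -
    obtain x where x: "x \<in> F" using F by auto
    have "\<exists>c. c \<in> F \<and> (\<forall>y. y \<in> F \<longrightarrow> card (I y) \<le> card (I c))"
      by (rule ex_has_greatest_nat[of "\<lambda>x. x \<in> F" x _ "Suc N"]) (use x bd in \<open>auto simp: less_Suc_eq_le\<close>)
    then obtain c where "c \<in> F" "\<forall>y. y \<in> F \<longrightarrow> card (I y) \<le> card (I c)" by (elim exE conjE)
    then show ?thesis by (intro that[of c]) auto
  qed
  have cH: "c \<in> hypercube N" using c FH by auto
  define J where "J = {..<N} - I c"
  define P where "P = {j\<in>J. c j = 1}"
  have cJ: "c j = of_bool (j \<in> P)" if "j \<in> J" for j
    using that cH by (auto simp: P_def J_def I_def hypercube_def)
  have "F = cube_face N J P"
  proof (intro equalityI subsetI)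
    fix x assume x: "x \<in> F"
    have xH: "x \<in> hypercube N" using x FH by auto
    show "x \<in> cube_face N J P"
    proof (rule ccontr)
      assume "x \<notin> cube_face N J P"
      then obtain j where j: "j \<in> J" "x j \<noteq> c j" using xH cJ by (auto simp: cube_face_def)
      \<comment> \<open>The midpoint keeps every free coordinate of \<open>c\<close> free and also
        frees \<open>j\<close>, where \<open>c\<close> is 0 or 1 and \<open>x\<close> differs. This
        contradicts the maximality of \<open>c\<close>.\<close>
      define y where "y = (1/2) *\<^sub>R x + (1/2) *\<^sub>R c"
      have "y \<in> F" unfolding y_def
        using F(1) x c(1) by (intro convexD[OF face_of_imp_convex[of F "hypercube N"]]) auto
      have yj: "y i = (x i + c i) / 2" for i by (simp add: y_def)
      have "I c \<subseteq> I y"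
      proof
        fix i assume "i \<in> I c"
        moreover from this have "0 \<le> x i" "x i \<le> 1" using xH by (auto simp: I_def hypercube_def)
        ultimately show "i \<in> I y" by (auto simp: I_def yj)
      qed
      moreover have "j \<in> I y"
      proof -
        have "j < N" "c j = 0 \<or> c j = 1" "0 \<le> x j" "x j \<le> 1"
          using j cJ xH by (auto simp: J_def hypercube_def)
        then show ?thesis using j(2) by (auto simp: I_def yj)
      qed
      moreover have "j \<notin> I c" using j by (simp add: J_def)
      ultimately have "I c \<subset> I y" by auto
      then have "card (I c) < card (I y)" by (intro psubset_card_mono) (auto simp: I_def)
      then show False using c(2)[OF \<open>y \<in> F\<close>] by simp
    qed
  next
    fix x assume x: "x \<in> cube_face N J P"
    show "x \<in> F"
    proof (cases "x = c")
      case False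
      have xH: "x \<in> hypercube N" using x by (simp add: cube_face_def)
      have "x j = c j" if "j < N" "\<not> (0 < c j \<and> c j < 1)" for j
      proof -
        have "j \<in> J" using that by (simp add: J_def I_def)
        then show ?thesis using x cJ by (simp add: cube_face_def)
      qed
      from extend_segment_in_hypercube[OF cH xH this]
      obtain t where t: "t > 0" "c + t *\<^sub>R (c - x) \<in> hypercube N" .
      have "c \<in> open_segment x (c + t *\<^sub>R (c - x))"
        using extend_segment_imp_open_segment[OF t(1) False] .
      then show ?thesis using face_ofD[OF F(1) _ xH t(2) c(1)] by blast
    qed (use c in auto)
  qed
  then show ?thesis using that[of P J] by (auto simp: P_def J_def)
qed

section \<open>Cube faces that survive a linear map\<close>

text \<open>Equivalently, any at most \<open>s\<close> of the first \<open>N\<close> columns of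
  \<open>L\<close> are linearly independent: the spark of the matrix exceeds
  \<open>s\<close>.\<close>

definition injective_on_sparse :: "((nat \<Rightarrow> real) \<Rightarrow> 'b::real_vector) \<Rightarrow> nat \<Rightarrow> nat \<Rightarrow> bool" where
  "injective_on_sparse L N s \<longleftrightarrow>
     (\<forall>I\<subseteq>{..<N}. card I \<le> s \<longrightarrow> (\<forall>z. (\<forall>j. j \<notin> I \<longrightarrow> z j = 0) \<longrightarrow> L z = 0 \<longrightarrow> z = 0))"

definition kernel :: "((nat \<Rightarrow> real) \<Rightarrow> 'b::real_vector) \<Rightarrow> nat \<Rightarrow> (nat \<Rightarrow> real) set" where
  "kernel L N = {z. L z = 0 \<and> (\<forall>j\<ge>N. z j = 0)}"

lemma injective_on_sparseD:
  assumes "injective_on_sparse L N s" "I \<subseteq> {..<N}" "card I \<le> s" "\<And>j. j \<notin> I \<Longrightarrow> z j = 0" "L z = 0"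
  shows "z = 0"
proof -
  have "\<forall>z. (\<forall>j. j \<notin> I \<longrightarrow> z j = 0) \<longrightarrow> L z = 0 \<longrightarrow> z = 0"
    using assms(1-3) unfolding injective_on_sparse_def by blast
  then show ?thesis using assms(4,5) by blast
qed

text \<open>The direction space of the image is spanned by the columns of the free coordinates.
  Sparsity \<open>k + 1\<close>, not \<open>k\<close>, is what excludes larger faces: with more than
  \<open>k\<close> free coordinates, \<open>k + 1\<close> of these columns would be independent
  inside a space of dimension \<open>k\<close>.\<close>

lemma has_aff_dim_image_cube_face:
  fixes L :: "(nat \<Rightarrow> real) \<Rightarrow> 'b::real_vector"
  assumes L: "linear L" and J: "P \<subseteq> J" "J \<subseteq> {..<N}" and k: "k < N"
    and ker: "injective_on_sparse L N (k + 1)"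
  shows "has_aff_dim (L ` cube_face N J P) k \<longleftrightarrow> card J = N - k"
proof -
  define v :: "nat \<Rightarrow> real" where "v = (\<lambda>j. of_bool (j \<in> P))"
  define I where "I = {..<N} - J"
  let ?u = "\<lambda>i. L (unit_vec i)"
  have fI: "finite I" by (simp add: I_def)
  have fJ: "finite J" using J by (meson finite_lessThan finite_subset)
  have cI: "card I = N - card J" using J fJ by (simp add: I_def card_Diff_subset)
  have cJ: "card J \<le> N" using card_mono[OF _ J(2)] by simp
  have v: "v \<in> cube_face N J P" using J by (auto simp: v_def cube_face_def hypercube_def)
  have span: "span ((\<lambda>x. x - L v) ` L ` cube_face N J P) = span (?u ` I)"
  proof (rule span_eq[THEN iffD2], intro conjI subsetI)
    fix y assume "y \<in> (\<lambda>x. x - L v) ` L ` cube_face N J P"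
    then obtain x where x: "x \<in> cube_face N J P" "y = L x - L v" by auto
    have "x - v = (\<Sum>i\<in>I. (x - v) i *\<^sub>R unit_vec i)"
      using x(1) v by (intro unit_vec_expansion fI) (force simp: cube_face_def hypercube_def I_def)
    then have "L (x - v) = L (\<Sum>i\<in>I. (x - v) i *\<^sub>R unit_vec i)" by (rule arg_cong)
    also have "\<dots> = (\<Sum>i\<in>I. (x - v) i *\<^sub>R ?u i)"
      by (simp only: linear_sum[OF L] linear_scale[OF L])
    also have "\<dots> \<in> span (?u ` I)"
      by (intro span_sum span_scale span_base) auto
    finally show "y \<in> span (?u ` I)" using x(2) by (simp add: linear_diff[OF L])
  next
    fix y assume "y \<in> ?u ` I"
    then obtain i where i: "i \<in> I" "y = ?u i" by auto
    have "v + unit_vec i \<in> cube_face N J P"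
      using i(1) J by (auto simp: v_def I_def unit_vec_def cube_face_def hypercube_def)
    moreover have "y = L (v + unit_vec i) - L v" using i(2) by (simp add: linear_add[OF L])
    ultimately show "y \<in> span ((\<lambda>x. x - L v) ` L ` cube_face N J P)"
      by (intro span_base) blast
  qed
  have indep: "inj_on ?u T" "independent (?u ` T)" if "T \<subseteq> I" "card T \<le> k + 1" for T
  proof -
    have T: "finite T" "T \<subseteq> {..<N}" using that fI finite_subset by (auto simp: I_def)
    show "inj_on ?u T" "independent (?u ` T)"
      by (rule independent_image_unit_vec[OF L T(1)];
          rule injective_on_sparseD[OF ker T(2) that(2)]; blast)+
  qed
  have "has_aff_dim (L ` cube_face N J P) k \<longleftrightarrow>
    (\<exists>B. independent B \<and> finite B \<and> card B = k \<and> span B = span (?u ` I))"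
    using has_aff_dim_iff[of "L v" "L ` cube_face N J P" k] v unfolding span by blast
  also have "\<dots> \<longleftrightarrow> card I = k"
  proof
    assume "\<exists>B. independent B \<and> finite B \<and> card B = k \<and> span B = span (?u ` I)"
    then obtain B where B: "independent B" "finite B" "card B = k" "span B = span (?u ` I)" by auto
    have le: "card T \<le> k" if "T \<subseteq> I" "card T \<le> k + 1" for T
    proof -
      have "?u ` T \<subseteq> span (?u ` I)" using that(1) by (intro subset_trans[OF _ span_superset]) auto
      then have "card (?u ` T) \<le> k"
        using independent_span_bound[OF B(2) indep(2)[OF that]] B(3,4) by auto
      then show ?thesis using indep(1)[OF that] by (simp add: card_image)
    qed
    have "card I \<le> k"
    proof (rule ccontr)
      assume "\<not> card I \<le> k"
      then obtain T where "T \<subseteq> I" "card T = k + 1"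
        by (metis Suc_eq_plus1 Suc_leI not_le obtain_subset_with_card_n)
      then show False using le[of T] by simp
    qed
    moreover have "k \<le> card (?u ` I)"
      using independent_span_bound[OF _ B(1), of "?u ` I"] fI span_superset[of B] B(3,4) by auto
    then have "k \<le> card I" using card_image_le[OF fI, of ?u] by linarith
    ultimately show "card I = k" by simp
  next
    assume "card I = k"
    then show "\<exists>B. independent B \<and> finite B \<and> card B = k \<and> span B = span (?u ` I)"
      using indep[of I] fI by (intro exI[of _ "?u ` I"]) (auto simp: card_image)
  qed
  also have "\<dots> \<longleftrightarrow> card J = N - k" using cI cJ k by auto
  finally show ?thesis .
qed

text \<open>If a point of the cube has the same image as a point of the face, their difference is a
  kernel vector pointing from the face into the cube, hence 0. So the face is the full preimage of
  its image, and the face property can be checked upstairs.\<close>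

lemma image_cube_face_is_face:
  fixes L :: "(nat \<Rightarrow> real) \<Rightarrow> 'b::real_vector"
  assumes L: "linear L" and J: "P \<subseteq> J" "J \<subseteq> {..<N}"
    and P: "P \<notin> weak_sign_patterns (kernel L N) J"
  shows "hypercube N \<inter> L -` L ` cube_face N J P = cube_face N J P"
    and "L ` cube_face N J P face_of L ` hypercube N"
proof -
  let ?H = "hypercube N" and ?F = "cube_face N J P"
  show pre: "?H \<inter> L -` L ` ?F = ?F"
  proof (intro equalityI subsetI)
    fix x assume x: "x \<in> ?H \<inter> L -` L ` ?F"
    then obtain f where f: "f \<in> ?F" "L x = L f" by auto
    have "x - f \<in> kernel L N"
      using x f by (auto simp: kernel_def linear_diff[OF L] cube_face_def hypercube_def)
    moreover have "\<forall>j\<in>P. (x - f) j \<le> 0" "\<forall>j\<in>J - P. 0 \<le> (x - f) j"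
      using x f J by (auto simp: cube_face_def hypercube_def subset_iff)
    ultimately have "x - f = 0" using J(1) P unfolding weak_sign_patterns_def by blast
    then show "x \<in> ?F" using f(1) by simp
  qed (auto simp: cube_face_def)
  show "L ` ?F face_of L ` ?H"
    unfolding face_of_def
  proof (intro conjI ballI impI)
    show "L ` ?F \<subseteq> L ` ?H" by (auto simp: cube_face_def)
    show "convex (L ` ?F)" using L convex_cube_face by (rule convex_linear_image)
    fix a' b' y assume ab: "a' \<in> L ` ?H" "b' \<in> L ` ?H" and y: "y \<in> L ` ?F" "y \<in> open_segment a' b'"
    then obtain a b u where a: "a \<in> ?H" "a' = L a" and b: "b \<in> ?H" "b' = L b"
      and u: "0 < u" "u < 1" "y = (1 - u) *\<^sub>R a' + u *\<^sub>R b'"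
      by (auto simp: in_segment)
    let ?c = "(1 - u) *\<^sub>R a + u *\<^sub>R b"
    have "?c \<in> ?H" using a b u convex_hypercube by (auto simp: convex_alt)
    moreover have "L ?c = y" using a b u by (simp add: linear_add[OF L] linear_scale[OF L])
    ultimately have c: "?c \<in> ?F" using y pre by blast
    \<comment> \<open>A convex combination with positive weights attains an endpoint of the unit
      interval only if both of its terms do.\<close>
    have "a j = of_bool (j \<in> P) \<and> b j = of_bool (j \<in> P)" if j: "j \<in> J" for j
    proof -
      have "j < N" using j J by auto
      then have r: "0 \<le> a j" "a j \<le> 1" "0 \<le> b j" "b j \<le> 1"
        using a b by (auto simp: hypercube_def)
      have e: "(1 - u) * a j + u * b j = of_bool (j \<in> P)"
        using c j by (auto simp: cube_face_def)
      show ?thesis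
      proof (cases "j \<in> P")
        case True
        have "(1 - u) * (1 - a j) + u * (1 - b j) = 0" using e True by (simp add: algebra_simps)
        moreover have "0 \<le> (1 - u) * (1 - a j)" "0 \<le> u * (1 - b j)" using u r by auto
        ultimately have "(1 - u) * (1 - a j) = 0" "u * (1 - b j) = 0" by linarith+
        then show ?thesis using u True by simp
      next
        case False
        have "(1 - u) * a j + u * b j = 0" using e False by simp
        moreover have "0 \<le> (1 - u) * a j" "0 \<le> u * b j" using u r by auto
        ultimately have "(1 - u) * a j = 0" "u * b j = 0" by linarith+
        then show ?thesis using u False by simp
      qed
    qed
    then show "a' \<in> L ` ?F" "b' \<in> L ` ?F" using a b by (auto simp: cube_face_def)
  qed
qed

text \<open>A converse: moving the centre of the face a little along \<open>z\<close> stays in the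
  cube without changing the image. As the face is a full preimage, the moved point stays in it, so
  \<open>z\<close> vanishes on the fixed coordinates.\<close>

lemma kernel_meets_cone_trivially:
  fixes L :: "(nat \<Rightarrow> real) \<Rightarrow> 'b::real_vector"
  assumes L: "linear L" and J: "P \<subseteq> J" "J \<subseteq> {..<N}"
    and pre: "hypercube N \<inter> L -` L ` cube_face N J P = cube_face N J P"
    and z: "L z = 0" "\<And>j. j \<ge> N \<Longrightarrow> z j = 0" "\<And>j. j \<in> P \<Longrightarrow> z j \<le> 0" "\<And>j. j \<in> J - P \<Longrightarrow> 0 \<le> z j"
    and j: "j \<in> J"
  shows "z j = 0"
proof -
  let ?c = "cube_center N J P"
  have c: "?c \<in> cube_face N J P" using J(2) by (rule cube_center_in_cube_face)
  \<comment> \<open>\<open>Z\<close> bounds every coordinate of \<open>z\<close>; the added 1 keeps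
    it positive even for \<open>z = 0\<close>. With \<open>t * Z = 1/2\<close> no coordinate moves
    by more than 1/2, the room that the centre leaves.\<close>
  define Z where "Z = (\<Sum>j<N. \<bar>z j\<bar>) + 1"
  define t where "t = 1 / (2 * Z)"
  have Z: "\<bar>z j\<bar> \<le> Z" if "j < N" for j
    using member_le_sum[of j "{..<N}" "\<lambda>j. \<bar>z j\<bar>"] that by (simp add: Z_def)
  have "Z > 0" by (simp add: Z_def sum_nonneg add_nonneg_pos)
  then have t: "t > 0" "t * Z = 1 / 2" by (auto simp: t_def)
  have small: "\<bar>t * z j\<bar> \<le> 1/2" if "j < N" for j
  proof -
    have "\<bar>t * z j\<bar> = t * \<bar>z j\<bar>" using t by (simp add: abs_mult)
    also have "\<dots> \<le> t * Z" using t Z[OF that] by (intro mult_left_mono) auto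
    finally show ?thesis using t by simp
  qed
  have "?c + t *\<^sub>R z \<in> hypercube N"
    unfolding hypercube_def
  proof (intro CollectI conjI allI impI)
    fix i assume i: "i < N"
    consider "i \<in> P" | "i \<in> J - P" | "i \<notin> J" by auto
    then have "0 \<le> (?c + t *\<^sub>R z) i \<and> (?c + t *\<^sub>R z) i \<le> 1"
    proof cases
      case 1
      then have "t * z i \<le> 0" using t z(3) by (simp add: mult_nonneg_nonpos)
      then show ?thesis using 1 J small[OF i] by (auto simp: cube_center_def abs_le_iff)
    next
      case 2
      then have "t * z i \<ge> 0" using t z(4) by simp
      then show ?thesis using 2 J small[OF i] by (auto simp: cube_center_def abs_le_iff)
    next
      case 3
      then show ?thesis using i small[OF i] by (auto simp: cube_center_def abs_le_iff)
    qed
    then show "0 \<le> (?c + t *\<^sub>R z) i" "(?c + t *\<^sub>R z) i \<le> 1" by auto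
  next
    fix i assume "N \<le> i"
    then show "(?c + t *\<^sub>R z) i = 0" using z(2) J(2) by (auto simp: cube_center_def)
  qed
  moreover have "L (?c + t *\<^sub>R z) = L ?c" by (simp add: linear_add[OF L] linear_scale[OF L] z)
  ultimately have "?c + t *\<^sub>R z \<in> cube_face N J P" using c pre by (metis IntI image_eqI vimageI)
  then show "z j = 0" using c j t by (simp add: cube_face_def)
qed

text \<open>The surviving pairs \<open>(J, P)\<close> correspond bijectively to the
  \<open>k\<close>-faces of the image: taking preimages recovers the cube face, and every face of
  the image pulls back to a cube face.\<close>

lemma num_faces_linear_image_hypercube:
  fixes L :: "(nat \<Rightarrow> real) \<Rightarrow> 'b::real_vector"
  assumes L: "linear L" and k: "k < N"
    and ker: "injective_on_sparse L N (k + 1)"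
  shows "num_faces k (L ` hypercube N) =
    card (SIGMA J:{J. J \<subseteq> {..<N} \<and> card J = N - k}. Pow J - weak_sign_patterns (kernel L N) J)"
    (is "_ = card ?D")
proof -
  let ?H = "hypercube N"
  let ?f = "\<lambda>(J, P). L ` cube_face N J P"
  let ?G = "{G. G face_of L ` ?H \<and> has_aff_dim G k}"
  have face: "?H \<inter> L -` L ` cube_face N J P = cube_face N J P"
      "L ` cube_face N J P face_of L ` ?H" if D: "(J, P) \<in> ?D" for J P
    using image_cube_face_is_face[OF L, of P J N] D by auto
  have "inj_on ?f ?D"
  proof (rule inj_onI)
    fix p q assume p: "p \<in> ?D" and q: "q \<in> ?D" and eq: "?f p = ?f q"
    obtain J P where pJ: "p = (J, P)" by (cases p)
    obtain J' P' where qJ: "q = (J', P')" by (cases q)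
    have "cube_face N J P = cube_face N J' P'"
      using face(1)[OF p[unfolded pJ]] face(1)[OF q[unfolded qJ]] eq unfolding pJ qJ split_conv by metis
    then show "p = q" using cube_face_eq_iff[of P J N P' J'] p q pJ qJ by auto
  qed
  moreover have "?f ` ?D = ?G"
  proof (intro equalityI subsetI)
    fix G assume "G \<in> ?f ` ?D"
    then obtain J P where JP: "(J, P) \<in> ?D" "G = L ` cube_face N J P" by auto
    then have "P \<subseteq> J" "J \<subseteq> {..<N}" "card J = N - k" by auto
    then have "has_aff_dim G k"
      using has_aff_dim_image_cube_face[OF L _ _ k ker, of P J] JP(2) by simp
    then show "G \<in> ?G" using face(2)[OF JP(1)] JP(2) by simp
  next
    fix G assume "G \<in> ?G"
    then have G: "G face_of L ` ?H" "has_aff_dim G k" by auto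
    have "G \<noteq> {}"
    proof
      assume "G = {}"
      then show False using G(2) by (auto simp: has_aff_dim_def)
    qed
    define F where "F = ?H \<inter> L -` G"
    have LF: "L ` F = G" and face_F: "F face_of ?H"
      using face_of_linear_preimage[OF L convex_hypercube G(1)] unfolding F_def by blast+
    have "F \<noteq> {}" using LF \<open>G \<noteq> {}\<close> by auto
    from face_of_hypercube[OF face_F this]
    obtain J P where J: "P \<subseteq> J" "J \<subseteq> {..<N}" and F: "F = cube_face N J P" .
    have cJ: "card J = N - k"
      using has_aff_dim_image_cube_face[OF L J k ker] G(2) LF F by simp
    have pre: "?H \<inter> L -` L ` cube_face N J P = cube_face N J P"
      using LF F by (simp add: F_def)
    have "P \<notin> weak_sign_patterns (kernel L N) J"
    proof
      assume "P \<in> weak_sign_patterns (kernel L N) J"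
      then obtain z where z: "L z = 0" "\<forall>j\<ge>N. z j = 0" "z \<noteq> 0" "\<forall>j\<in>P. z j \<le> 0" "\<forall>j\<in>J - P. 0 \<le> z j"
        unfolding weak_sign_patterns_def kernel_def by auto
      have "finite J" using J(2) finite_subset by blast
      \<comment> \<open>The vector \<open>z\<close> vanishes on the \<open>N - k\<close> coordinates
        of \<open>J\<close>, so its support has at most \<open>k\<close> elements and sparse
        injectivity forces \<open>z = 0\<close>.\<close>
      then have "card ({..<N} - J) \<le> k + 1" using J(2) cJ k by (simp add: card_Diff_subset)
      moreover have "z j = 0" if "j \<notin> {..<N} - J" for j
        using that kernel_meets_cone_trivially[OF L J pre z(1), of j] z by (cases "j < N") auto
      ultimately have "z = 0" using injective_on_sparseD[OF ker Diff_subset _ _ z(1)] by blast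
      then show False using z(3) by simp
    qed
    then have "(J, P) \<in> ?D" using J cJ by blast
    then show "G \<in> ?f ` ?D" using LF F by (intro image_eqI[of _ _ "(J, P)"]) auto
  qed
  ultimately have "bij_betw ?f ?D ?G" by (simp add: bij_betw_def)
  then show ?thesis unfolding num_faces_def by (simp add: bij_betw_same_card)
qed

section \<open>Binomial tails\<close>

text \<open>The variance n/4 of a fair binomial variable, read off from the moment identities of the
  Bernstein polynomials at 1/2.\<close>

lemma binomial_second_moment:
  "(\<Sum>i\<le>n. real (n choose i) * (real i - real n / 2)\<^sup>2) = real n / 4 * 2 ^ n"
proof -
  have B: "Bernstein n i (1/2) = real (n choose i) / 2 ^ n" if "i \<le> n" for i
  proof -
    have "(1/2::real) ^ i * (1/2) ^ (n - i) = (1/2) ^ n"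
      using that by (simp flip: power_add)
    then show ?thesis by (simp add: Bernstein_def power_one_over mult.assoc)
  qed
  \<comment> \<open>The square equals i (i - 1) + (1 - n) i + n^2/4, which matches the available
    moments.\<close>
  have "(\<Sum>i\<le>n. (real i - real n / 2)\<^sup>2 * Bernstein n i (1/2)) =
    (\<Sum>i\<le>n. real i * (real i - 1) * Bernstein n i (1/2))
    + (1 - real n) * (\<Sum>i\<le>n. real i * Bernstein n i (1/2))
    + (real n)\<^sup>2 / 4 * (\<Sum>i\<le>n. Bernstein n i (1/2))"
    unfolding sum_distrib_left sum.distrib[symmetric]
    by (intro sum.cong refl) (simp add: power2_eq_square field_simps)
  also have "\<dots> = real n / 4"
    unfolding sum_kk_Bernstein sum_k_Bernstein sum_Bernstein by (simp add: power2_eq_square field_simps)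
  finally have "(\<Sum>i\<le>n. (real i - real n / 2)\<^sup>2 * (real (n choose i) / 2 ^ n)) = real n / 4"
    using B by simp
  then have "(\<Sum>i\<le>n. (real i - real n / 2)\<^sup>2 * real (n choose i)) / 2 ^ n = real n / 4"
    by (simp add: sum_divide_distrib)
  then show ?thesis by (simp add: field_simps)
qed

text \<open>Chebyshev's inequality; an arbitrary set \<open>T\<close> lets it serve both the lower
  and the upper tail.\<close>

lemma binomial_tail_bound:
  assumes "T \<subseteq> {..n}" "t > 0" "\<And>i. i \<in> T \<Longrightarrow> t \<le> \<bar>real i - real n / 2\<bar>"
  shows "(\<Sum>i\<in>T. real (n choose i)) / 2 ^ n \<le> real n / (4 * t\<^sup>2)"
proof -
  have "t\<^sup>2 * (\<Sum>i\<in>T. real (n choose i)) \<le> (\<Sum>i\<in>T. real (n choose i) * (real i - real n / 2)\<^sup>2)"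
    unfolding sum_distrib_left
  proof (rule sum_mono)
    fix i assume "i \<in> T"
    then have "t\<^sup>2 \<le> (real i - real n / 2)\<^sup>2"
      using assms(2,3) by (metis abs_le_square_iff abs_of_pos)
    then show "t\<^sup>2 * real (n choose i) \<le> real (n choose i) * (real i - real n / 2)\<^sup>2"
      by (simp add: mult.commute mult_left_mono)
  qed
  also have "\<dots> \<le> (\<Sum>i\<le>n. real (n choose i) * (real i - real n / 2)\<^sup>2)"
    using assms(1) by (intro sum_mono2) auto
  also have "\<dots> = real n / 4 * 2 ^ n" by (rule binomial_second_moment)
  finally show ?thesis using assms(2) by (simp add: field_simps)
qed

text \<open>Away from \<open>\<mu> = r / 2\<close> the cutoff is at distance of order n from the
  mean, while the variance grows at most linearly. Chebyshev then bounds the relevant tail by a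
  quantity of order 1/n.\<close>

lemma binomial_prefix_limit:
  fixes m R :: "nat \<Rightarrow> nat"
  assumes R: "(\<lambda>n. real (R n) / real n) \<longlonglongrightarrow> r" and m: "(\<lambda>n. real (m n) / real n) \<longlonglongrightarrow> \<mu>"
  shows "\<mu> < r / 2 \<Longrightarrow> (\<lambda>n. (\<Sum>i<m n. real (R n choose i)) / 2 ^ R n) \<longlonglongrightarrow> 0"
    and "\<mu> > r / 2 \<Longrightarrow> (\<lambda>n. (\<Sum>i<m n. real (R n choose i)) / 2 ^ R n) \<longlonglongrightarrow> 1"
proof -
  let ?f = "\<lambda>n. (\<Sum>i<m n. real (R n choose i)) / 2 ^ R n"
  let ?t = "\<lambda>n. real (m n) - real (R n) / 2"
  have t: "(\<lambda>n. ?t n / real n) \<longlonglongrightarrow> \<mu> - r / 2"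
  proof -
    have "(\<lambda>n. real (m n) / real n - real (R n) / real n / 2) \<longlonglongrightarrow> \<mu> - r / 2"
      by (intro tendsto_intros R m) simp
    then show ?thesis by (simp add: diff_divide_distrib mult.commute)
  qed
  have bound: "(\<lambda>n. real (R n) / (4 * (?t n)\<^sup>2)) \<longlonglongrightarrow> 0" if "\<mu> \<noteq> r / 2"
  proof -
    have "(\<lambda>n. real (R n) / real n * (1 / real n) / (4 * (?t n / real n)\<^sup>2)) \<longlonglongrightarrow> r * 0 / (4 * (\<mu> - r / 2)\<^sup>2)"
      using that by (intro tendsto_divide tendsto_mult tendsto_power tendsto_const R t lim_1_over_n) simp
    moreover have "\<forall>\<^sub>F n in sequentially. real (R n) / real n * (1 / real n) / (4 * (?t n / real n)\<^sup>2) =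
      real (R n) / (4 * (?t n)\<^sup>2)"
      using eventually_gt_at_top[of 0] by eventually_elim (simp add: power_divide power2_eq_square)
    ultimately have "(\<lambda>n. real (R n) / (4 * (?t n)\<^sup>2)) \<longlonglongrightarrow> r * 0 / (4 * (\<mu> - r / 2)\<^sup>2)"
      by (rule Lim_transform_eventually)
    then show ?thesis by simp
  qed
  have total: "(\<Sum>i\<le>R n. real (R n choose i)) = 2 ^ R n" for n
    using choose_row_sum[of "R n"] by (metis of_nat_numeral of_nat_power of_nat_sum)
  \<comment> \<open>The cutoff \<open>m n\<close> may exceed \<open>R n\<close>; the extra binomial
    coefficients are zero, and clipping puts the index set in the range required by the tail
    bound.\<close>
  have clip: "(\<Sum>i<m n. real (R n choose i)) = (\<Sum>i\<in>{..R n} \<inter> {..<m n}. real (R n choose i))" for n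
    by (rule sum.mono_neutral_right) auto
  {
    assume lt: "\<mu> < r / 2"
    have "\<forall>\<^sub>F n in sequentially. ?t n / real n < 0"
      using order_tendstoD(2)[OF t, of 0] lt by simp
    then have up: "\<forall>\<^sub>F n in sequentially. ?f n \<le> real (R n) / (4 * (?t n)\<^sup>2)"
    proof eventually_elim
      case (elim n)
      then have neg: "?t n < 0" by (simp add: divide_less_0_iff)
      have "?f n \<le> real (R n) / (4 * (- ?t n)\<^sup>2)"
        unfolding clip using neg by (intro binomial_tail_bound) auto
      then show ?case by (simp only: power2_minus)
    qed
    have low: "\<forall>\<^sub>F n in sequentially. 0 \<le> ?f n"
      by (intro always_eventually allI divide_nonneg_nonneg sum_nonneg) auto
    have "\<mu> \<noteq> r / 2" using lt by simp
    from tendsto_sandwich[OF low up tendsto_const bound[OF this]]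
    show "?f \<longlonglongrightarrow> 0" .
  }
  {
    assume gt: "\<mu> > r / 2"
    have "\<forall>\<^sub>F n in sequentially. ?t n / real n > 0"
      using order_tendstoD(1)[OF t, of 0] gt by simp
    then have low: "\<forall>\<^sub>F n in sequentially. 1 - real (R n) / (4 * (?t n)\<^sup>2) \<le> ?f n"
    proof eventually_elim
      case (elim n)
      then have pos: "?t n > 0" by (simp add: zero_less_divide_iff)
      have "(\<Sum>i\<in>{..R n} - {..<m n}. real (R n choose i)) / 2 ^ R n \<le> real (R n) / (4 * (?t n)\<^sup>2)"
        using pos by (intro binomial_tail_bound) auto
      moreover have "(\<Sum>i\<in>{..R n} - {..<m n}. real (R n choose i)) / 2 ^ R n = 1 - ?f n"
      proof -
        have "(\<Sum>i\<le>R n. real (R n choose i)) =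
          (\<Sum>i\<in>{..R n} \<inter> {..<m n}. real (R n choose i)) + (\<Sum>i\<in>{..R n} - {..<m n}. real (R n choose i))"
          by (rule sum.Int_Diff) simp
        then have "(\<Sum>i\<in>{..R n} - {..<m n}. real (R n choose i)) =
          2 ^ R n - (\<Sum>i<m n. real (R n choose i))"
          unfolding total clip by simp
        then show ?thesis by (simp add: diff_divide_distrib)
      qed
      ultimately show ?case by simp
    qed
    have up: "\<forall>\<^sub>F n in sequentially. ?f n \<le> 1"
    proof (intro always_eventually allI)
      fix n
      have "(\<Sum>i<m n. real (R n choose i)) \<le> (\<Sum>i\<le>R n. real (R n choose i))"
        unfolding clip by (intro sum_mono2) auto
      then show "?f n \<le> 1" unfolding total by simp
    qed
    have lim: "(\<lambda>n. 1 - real (R n) / (4 * (?t n)\<^sup>2)) \<longlonglongrightarrow> 1"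
      using tendsto_diff[OF tendsto_const[of 1] bound] gt by simp
    show "?f \<longlonglongrightarrow> 1" by (rule tendsto_sandwich[OF low up lim tendsto_const])
  }
qed

section \<open>Generic nullspaces\<close>

text \<open>The combination runs over indices, not over the image set, so coinciding vectors
  \<open>f i\<close> do no harm.\<close>

lemma in_span_image_iff:
  assumes "finite A"
  shows "w \<in> span (f ` A) \<longleftrightarrow> (\<exists>y. w = (\<Sum>i\<in>A. y i *\<^sub>R f i))"
proof
  let ?g = "\<lambda>y. \<Sum>i\<in>A. y i *\<^sub>R f i"
  have "linear ?g"
    by (rule linearI) (simp_all add: scaleR_left_distrib sum.distrib scaleR_sum_right)
  then have "subspace (range ?g)" by (rule linear_subspace_image) simp
  moreover have "f ` A \<subseteq> range ?g"
  proof
    fix v assume "v \<in> f ` A"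
    then obtain i where i: "i \<in> A" "v = f i" by auto
    have "(\<Sum>j\<in>A. of_bool (j = i) *\<^sub>R f j) = (\<Sum>j\<in>A. if j = i then f j else 0)"
      by (intro sum.cong) auto
    also have "\<dots> = v" using assms i by simp
    finally have "?g (\<lambda>j. of_bool (j = i)) = v" .
    then show "v \<in> range ?g" by (intro image_eqI[of _ _ "\<lambda>j. of_bool (j = i)"]) auto
  qed
  ultimately have "span (f ` A) \<subseteq> range ?g" by (intro span_minimal)
  then show "w \<in> span (f ` A) \<Longrightarrow> \<exists>y. w = ?g y" by auto
  show "\<exists>y. w = ?g y \<Longrightarrow> w \<in> span (f ` A)"
    by (auto intro: span_sum span_scale span_base)
qed

lemma in_row_span_iff:
  "w \<in> row_span m N B \<longleftrightarrow> (\<exists>y. w = (\<lambda>j. if j < N then \<Sum>i<m. y i * B (i, j) else 0))"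
proof -
  have "(\<Sum>i<m. y i *\<^sub>R row_vec N B i) = (\<lambda>j. if j < N then \<Sum>i<m. y i * B (i, j) else 0)" for y
    by (rule ext) (simp add: sum_fun_apply row_vec_def)
  then show ?thesis unfolding row_span_def by (simp add: in_span_image_iff)
qed

text \<open>\<open>m\<close> independent vectors of R^m span it: otherwise adjoining a unit vector
  would give \<open>m + 1\<close> independent vectors in the span of \<open>m\<close> unit
  vectors.\<close>

lemma unit_vec_in_span_of_independent:
  assumes C: "independent C" "card C = m" "finite C" "\<And>v i. v \<in> C \<Longrightarrow> i \<ge> m \<Longrightarrow> v i = 0" and i: "i < m"
  shows "unit_vec i \<in> span C"
proof (rule ccontr)
  assume n: "unit_vec i \<notin> span C"
  let ?U = "unit_vec ` {..<m}"
  have "v \<in> span ?U" if "v \<in> C" for v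
  proof -
    have "v = (\<Sum>i<m. v i *\<^sub>R unit_vec i)" using C(4)[OF that] by (intro unit_vec_expansion) auto
    also have "\<dots> \<in> span ?U" by (intro span_sum span_scale span_base) auto
    finally show ?thesis .
  qed
  moreover have "unit_vec i \<in> span ?U" using i by (intro span_base) auto
  ultimately have "insert (unit_vec i) C \<subseteq> span ?U" by auto
  moreover have "independent (insert (unit_vec i) C)" using n C(1) by (rule independent_insertI)
  ultimately have "card (insert (unit_vec i) C) \<le> card ?U"
    using independent_span_bound[of ?U "insert (unit_vec i) C"] by simp
  also have "\<dots> \<le> m" using card_image_le[of "{..<m}" unit_vec] by simp
  finally show False using C(2,3) n span_superset[of C] by (auto simp: card_insert_if split: if_splits)
qed

text \<open>An element of the row span is given by coefficients \<open>y\<close>, and its value at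
  \<open>j\<close> is the pairing of \<open>y\<close> with column \<open>j\<close>. Any
  \<open>m\<close> columns form a basis of R^m, so values on them determine \<open>y\<close> and can
  be prescribed freely.\<close>

lemma general_position_row_span:
  assumes mN: "m \<le> N"
    and gen: "\<And>J. J \<subseteq> {..<N} \<Longrightarrow> card J = m \<Longrightarrow>
      inj_on (col_vec m B) J \<and> independent (col_vec m B ` J)"
  shows "general_position (row_span m N B) {..<N} m"
  unfolding general_position_def
proof (intro conjI allI impI ballI)
  show "subspace (row_span m N B)" unfolding row_span_def by (rule subspace_span)
  have spans: "unit_vec i \<in> span (col_vec m B ` J)" if J: "J \<subseteq> {..<N}" "card J = m" and i: "i < m" for J i
  proof (rule unit_vec_in_span_of_independent[OF _ _ _ _ i])
    show "independent (col_vec m B ` J)" "card (col_vec m B ` J) = m" "finite (col_vec m B ` J)"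
      using gen[OF J] J finite_subset by (auto simp: card_image)
    show "\<And>v i. v \<in> col_vec m B ` J \<Longrightarrow> m \<le> i \<Longrightarrow> v i = 0" by (auto simp: col_vec_def)
  qed
  fix T assume T: "T \<subseteq> {..<N}"
  {
    fix w assume mT: "m \<le> card T" and w: "w \<in> row_span m N B" "\<forall>j\<in>T. w j = 0"
    obtain J where J: "J \<subseteq> T" "card J = m" using obtain_subset_with_card_n[OF mT] by blast
    then have JN: "J \<subseteq> {..<N}" using T by auto
    obtain y where y: "w = (\<lambda>j. if j < N then \<Sum>i<m. y i * B (i, j) else 0)"
      using w(1) unfolding in_row_span_iff by auto
    define \<phi> where "\<phi> = (\<lambda>v::nat \<Rightarrow> real. \<Sum>i<m. y i * v i)"
    have "linear \<phi>"
      unfolding \<phi>_def by (rule linearI) (simp_all add: algebra_simps sum.distrib sum_distrib_left)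
    moreover have "\<phi> v = 0" if v: "v \<in> col_vec m B ` J" for v
    proof -
      obtain j where j: "j \<in> J" "v = col_vec m B j" using v by auto
      have "\<phi> v = w j" using j JN by (auto simp: \<phi>_def y col_vec_def)
      then show ?thesis using w(2) j J by auto
    qed
    ultimately have 0: "\<phi> (unit_vec i) = 0" if "i < m" for i
      using linear_eq_0_on_span[OF _ _ spans[OF JN J(2) that]] by blast
    have "y i = 0" if "i < m" for i
    proof -
      have "\<phi> (unit_vec i) = (\<Sum>l<m. if l = i then y l else 0)"
        unfolding \<phi>_def by (intro sum.cong) (auto simp: unit_vec_def)
      then show ?thesis using 0[OF that] that by (simp add: sum.delta)
    qed
    then show "w = 0" unfolding y by (intro ext) simp
  }
  {
    fix v :: "nat \<Rightarrow> real" assume Tm: "card T \<le> m"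
    obtain J where J: "T \<subseteq> J" "J \<subseteq> {..<N}" "card J = m"
      using exists_subset_between[OF Tm _ T] mN by auto
    let ?c = "col_vec m B"
    have inj: "inj_on ?c J" and indep: "independent (?c ` J)" using gen[OF J(2,3)] by auto
    \<comment> \<open>Injectivity on \<open>J\<close> lets a value be attached to a column through
      its index. The functional \<open>g\<close> then supplies the row coefficients as its values on
      the unit vectors.\<close>
    have "\<exists>g. linear g \<and> (\<forall>x\<in>?c ` J. g x = v (inv_into J ?c x))"
      by (rule linear_independent_extend[OF indep])
    then obtain g :: "(nat \<Rightarrow> real) \<Rightarrow> real" where g: "linear g" "\<forall>x\<in>?c ` J. g x = v (inv_into J ?c x)"
      by (elim exE conjE)
    define w where "w = (\<lambda>j. if j < N then \<Sum>i<m. g (unit_vec i) * B (i, j) else 0)"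
    have "w \<in> row_span m N B" unfolding in_row_span_iff w_def by (rule exI) (rule refl)
    moreover have "w j = v j" if "j \<in> T" for j
    proof -
      have j: "j \<in> J" "j < N" using that J T by auto
      have "?c j = (\<Sum>i<m. ?c j i *\<^sub>R unit_vec i)"
        by (rule unit_vec_expansion) (auto simp: col_vec_def)
      then have "g (?c j) = g (\<Sum>i<m. ?c j i *\<^sub>R unit_vec i)" by (rule arg_cong)
      also have "\<dots> = (\<Sum>i<m. ?c j i * g (unit_vec i))"
        by (simp only: linear_sum[OF g(1)] linear_scale[OF g(1)] real_scaleR_def)
      also have "\<dots> = w j" using j by (simp add: w_def col_vec_def mult.commute)
      finally show ?thesis using g(2) j inj by simp
    qed
    ultimately show "\<exists>w\<in>row_span m N B. \<forall>j\<in>T. w j = v j" by blast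
  }
qed

section \<open>Exact face counts and the expected ratio\<close>

lemma card_subsets_codim:
  assumes "k \<le> N"
  shows "card {J. J \<subseteq> {..<N} \<and> card J = N - k} = N choose k"
  using n_subsets[of "{..<N}" "N - k"] binomial_symmetric[OF assms] by simp

text \<open>The identity map has trivial kernel, so no set \<open>P\<close> is spoiled and all pairs
  \<open>(J, P)\<close> count.\<close>

lemma num_faces_hypercube:
  assumes k: "k < N"
  shows "num_faces k (hypercube N) = (N choose k) * 2 ^ (N - k)"
proof -
  let ?Js = "{J. J \<subseteq> {..<N} \<and> card J = N - k}"
  have fin: "finite ?Js" "\<And>J. J \<in> ?Js \<Longrightarrow> finite J"
    by (auto intro: finite_subset[of _ "Pow {..<N}"] finite_subset[of _ "{..<N}"])
  have W: "weak_sign_patterns (kernel id N) J = {}" for J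
    by (auto simp: weak_sign_patterns_def kernel_def)
  have inj: "injective_on_sparse id N (k + 1)" unfolding injective_on_sparse_def id_apply by blast
  have "num_faces k (id ` hypercube N) = card (SIGMA J:?Js. Pow J)"
    using num_faces_linear_image_hypercube[OF linear_id k inj] unfolding W Diff_empty .
  also have "\<dots> = (\<Sum>J\<in>?Js. card (Pow J))"
    by (rule card_SigmaI[OF fin(1)]) (intro ballI finite_Pow_iff[THEN iffD2] finite_Diff fin(2))
  also have "\<dots> = (\<Sum>J\<in>?Js. 2 ^ (N - k))"
  proof (rule sum.cong[OF refl])
    fix J assume J: "J \<in> ?Js"
    show "card (Pow J) = 2 ^ (N - k)" using card_Pow[OF fin(2)[OF J]] J by simp
  qed
  also have "\<dots> = (N choose k) * 2 ^ (N - k)" using k by (simp add: card_subsets_codim)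
  finally show ?thesis by simp
qed

lemma linear_mat_apply: "linear (mat_apply m N A)"
  by (rule linearI)
    (auto simp: mat_apply_def fun_eq_iff algebra_simps sum.distrib sum_distrib_left)

lemma num_faces_mat_apply_hypercube:
  assumes k: "k < n" and n: "n < N" and W: "general_position (nullspace n N A) {..<N} (N - n)"
  shows "num_faces k (mat_apply n N A ` hypercube N) =
    (N choose k) * (2 ^ (N - k) - 2 * (\<Sum>i<N - n. (N - k - 1) choose i))"
proof -
  let ?L = "mat_apply n N A" and ?Js = "{J. J \<subseteq> {..<N} \<and> card J = N - k}"
  have fin: "finite ?Js" "\<And>J. J \<in> ?Js \<Longrightarrow> finite J"
    by (auto intro: finite_subset[of _ "Pow {..<N}"] finite_subset[of _ "{..<N}"])
  have ker: "kernel ?L N = nullspace n N A" by (auto simp: kernel_def nullspace_def zero_fun_def)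
  have inj: "injective_on_sparse ?L N (k + 1)"
    unfolding injective_on_sparse_def
  proof (intro allI impI)
    fix I z assume I: "I \<subseteq> {..<N}" "card I \<le> k + 1" and z: "\<forall>j. j \<notin> I \<longrightarrow> z j = 0" "?L z = 0"
    show "z = 0"
    \<comment> \<open>As \<open>k + 1 \<le> n\<close>, the vector vanishes on at least
      \<open>N - n\<close> coordinates.\<close>
    proof (rule general_position_eq_0[OF W])
      show "{..<N} - I \<subseteq> {..<N}" by auto
      have "finite I" using I(1) finite_subset by blast
      then show "N - n \<le> card ({..<N} - I)" using I k n by (simp add: card_Diff_subset)
      have "z j = 0" if "j \<ge> N" for j using z(1) I(1) that by force
      then show "z \<in> nullspace n N A" using z(2) unfolding ker[symmetric] kernel_def by blast
      show "\<And>j. j \<in> {..<N} - I \<Longrightarrow> z j = 0" using z(1) by blast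
    qed
  qed
  have fibre: "card (Pow J - weak_sign_patterns (nullspace n N A) J) =
    2 ^ (N - k) - 2 * (\<Sum>i<N - n. (N - k - 1) choose i)" if J: "J \<in> ?Js" for J
  proof -
    have gp: "general_position (nullspace n N A) J (N - n)"
      using general_position_subset[OF W] J by blast
    have ne: "J \<noteq> {}" "N - n \<le> card J" using J k n by auto
    have "weak_sign_patterns (nullspace n N A) J = sign_patterns (nullspace n N A) J"
      by (rule weak_sign_patterns_eq[OF gp fin(2)[OF J] ne])
    moreover have "card (sign_patterns (nullspace n N A) J) = 2 * (\<Sum>i<N - n. (N - k - 1) choose i)"
      using card_sign_patterns[OF fin(2)[OF J] ne(1) gp] J by simp
    moreover have "sign_patterns (nullspace n N A) J \<subseteq> Pow J" by (auto simp: sign_patterns_def)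
    ultimately show ?thesis using fin(2)[OF J] J
      by (subst card_Diff_subset) (auto simp: card_Pow intro: finite_subset)
  qed
  have "num_faces k (?L ` hypercube N) =
    card (SIGMA J:?Js. Pow J - weak_sign_patterns (nullspace n N A) J)"
    using num_faces_linear_image_hypercube[OF linear_mat_apply _ inj] k n unfolding ker by simp
  also have "\<dots> = (\<Sum>J\<in>?Js. card (Pow J - weak_sign_patterns (nullspace n N A) J))"
    by (rule card_SigmaI[OF fin(1)]) (intro ballI finite_Pow_iff[THEN iffD2] finite_Diff fin(2))
  also have "\<dots> = (\<Sum>J\<in>?Js. 2 ^ (N - k) - 2 * (\<Sum>i<N - n. (N - k - 1) choose i))"
    using fibre by (rule sum.cong[OF refl])
  also have "\<dots> = (N choose k) * (2 ^ (N - k) - 2 * (\<Sum>i<N - n. (N - k - 1) choose i))"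
    using k n by (simp add: card_subsets_codim)
  finally show ?thesis .
qed

text \<open>There are only finitely many column sets \<open>J\<close>, so almost surely all of them
  are independent at once.\<close>

lemma AE_general_position_nullspace:
  assumes "n < N" "orthant_symmetric_generic_nullspace M n N A"
  shows "AE \<omega> in M. general_position (nullspace n N (A \<omega>)) {..<N} (N - n)"
proof -
  obtain B where gen: "generic_matrix M (N - n) N B"
    and null: "AE \<omega> in M. nullspace n N (A \<omega>) = row_span (N - n) N (B \<omega>)"
    using assms(2) unfolding orthant_symmetric_generic_nullspace_def by blast
  let ?Js = "{J. J \<subseteq> {..<N} \<and> card J = N - n}"
  have "finite ?Js" by (rule finite_subset[of _ "Pow {..<N}"]) auto
  moreover have "\<forall>J\<in>?Js. AE \<omega> in M. inj_on (col_vec (N - n) (B \<omega>)) J \<and>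
      independent (col_vec (N - n) (B \<omega>) ` J)"
    using gen unfolding generic_matrix_def by blast
  ultimately have "AE \<omega> in M. \<forall>J\<in>?Js. inj_on (col_vec (N - n) (B \<omega>)) J \<and>
      independent (col_vec (N - n) (B \<omega>) ` J)"
    by (intro AE_finite_allI) auto
  with null show ?thesis
  proof eventually_elim
    case (elim \<omega>)
    have "general_position (row_span (N - n) N (B \<omega>)) {..<N} (N - n)"
      using elim(2) by (intro general_position_row_span) auto
    then show ?case using elim(1) by simp
  qed
qed

text \<open>The face count equals a constant almost surely, and its integral over a probability
  space is that constant. Cancelling the factor 2 against \<open>2 ^ (N - k)\<close> lowers the
  exponent by one.\<close>

lemma expected_face_ratio:
  assumes k: "k < n" and n: "n < N" and M: "prob_space M"
    and A: "orthant_symmetric_generic_nullspace M n N A"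
  shows "(\<integral>\<^sup>+ \<omega>. of_nat (num_faces k (mat_apply n N (A \<omega>) ` hypercube N)) \<partial>M)
      / of_nat (num_faces k (hypercube N)) =
    ennreal (1 - (\<Sum>i<N - n. real ((N - k - 1) choose i)) / 2 ^ (N - k - 1))"
proof -
  interpret prob_space M by (rule M)
  define R where "R = N - k - 1"
  define S where "S = (\<Sum>i<N - n. R choose i)"
  have Nk: "N - k = Suc R" using k n by (simp add: R_def)
  have "S = (\<Sum>i\<in>{..R} \<inter> {..<N - n}. R choose i)"
    unfolding S_def by (rule sum.mono_neutral_right) auto
  also have "\<dots> \<le> (\<Sum>i\<le>R. R choose i)" by (rule sum_mono2) auto
  \<comment> \<open>This bound makes the truncated subtraction of naturals an exact one when passing
    to the reals.\<close>
  finally have S: "S \<le> 2 ^ R" by (simp add: choose_row_sum)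
  have "AE \<omega> in M. (of_nat (num_faces k (mat_apply n N (A \<omega>) ` hypercube N)) :: ennreal) =
    of_nat ((N choose k) * (2 ^ Suc R - 2 * S))"
    using AE_general_position_nullspace[OF n A]
  proof eventually_elim
    case (elim \<omega>)
    then show ?case using num_faces_mat_apply_hypercube[OF k n elim]
      by (simp only: Nk S_def diff_Suc_1)
  qed
  then have "(\<integral>\<^sup>+ \<omega>. of_nat (num_faces k (mat_apply n N (A \<omega>) ` hypercube N)) \<partial>M) =
    (\<integral>\<^sup>+ \<omega>. of_nat ((N choose k) * (2 ^ Suc R - 2 * S)) \<partial>M)"
    by (rule nn_integral_cong_AE)
  also have "\<dots> = ennreal (real ((N choose k) * (2 ^ Suc R - 2 * S)))"
    by (simp only: nn_integral_const emeasure_space_1 mult_1_right ennreal_of_nat_eq_real_of_nat)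
  finally have E: "(\<integral>\<^sup>+ \<omega>. of_nat (num_faces k (mat_apply n N (A \<omega>) ` hypercube N)) \<partial>M) =
    ennreal (real ((N choose k) * (2 ^ Suc R - 2 * S)))" .
  have D: "of_nat (num_faces k (hypercube N)) = ennreal (real ((N choose k) * 2 ^ Suc R))"
    using k n num_faces_hypercube[of k N] Nk by (simp only: ennreal_of_nat_eq_real_of_nat less_trans)
  have pos: "real ((N choose k) * 2 ^ Suc R) > 0" using k n by (simp add: zero_less_binomial_iff)
  have "real ((N choose k) * (2 ^ Suc R - 2 * S)) / real ((N choose k) * 2 ^ Suc R) = 1 - real S / 2 ^ R"
  proof -
    have "real (2 ^ Suc R - 2 * S) = 2 ^ Suc R - 2 * real S"
      using S by (subst of_nat_diff) auto
    then have "real ((N choose k) * (2 ^ Suc R - 2 * S)) / real ((N choose k) * 2 ^ Suc R) =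
      (2 ^ Suc R - 2 * real S) / 2 ^ Suc R"
      using k n by (simp del: power_Suc)
    also have "\<dots> = 1 - real S / 2 ^ R" by (simp add: diff_divide_distrib)
    finally show ?thesis .
  qed
  then show ?thesis
    unfolding E D R_def[symmetric] using pos
    by (subst divide_ennreal) (auto simp: S_def)
qed

theorem theorem1p5:
  fixes \<rho> \<delta> :: real
    and k N :: "nat \<Rightarrow> nat"
    and M :: "nat \<Rightarrow> 'w measure"
    and A :: "nat \<Rightarrow> 'w \<Rightarrow> rmat"
  assumes "0 < \<rho>" "\<rho> < 1" "0 < \<delta>" "\<delta> < 1"
    and "\<And>n. n \<ge> 1 \<Longrightarrow> k n < n"
    and "\<And>n. n \<ge> 1 \<Longrightarrow> n < N n"
    and "(\<lambda>n. real (k n) / real n) \<longlonglongrightarrow> \<rho>"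
    and "(\<lambda>n. real n / real (N n)) \<longlonglongrightarrow> \<delta>"
    and "\<And>n. n \<ge> 1 \<Longrightarrow> prob_space (M n)"
    and "\<And>n. n \<ge> 1 \<Longrightarrow> A n \<in> measurable (M n) (mat_borel n (N n))"
    and "\<And>n. n \<ge> 1 \<Longrightarrow> orthant_symmetric_generic_nullspace (M n) n (N n) (A n)"
  defines "ratio \<equiv> \<lambda>n.
      (\<integral>\<^sup>+ \<omega>. of_nat (num_faces (k n) (mat_apply n (N n) (A n \<omega>) ` hypercube (N n))) \<partial>M n)
        / of_nat (num_faces (k n) (hypercube (N n)))"
  shows "(\<rho> < rho_W_cube \<delta> \<longrightarrow> ratio \<longlonglongrightarrow> 1) \<and> (\<rho> > rho_W_cube \<delta> \<longrightarrow> ratio \<longlonglongrightarrow> 0)"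
proof -
  define R where "R = (\<lambda>n. N n - k n - 1)"
  define m where "m = (\<lambda>n. N n - n)"
  define f where "f = (\<lambda>n. (\<Sum>i<m n. real (R n choose i)) / 2 ^ R n)"
  have ev: "\<forall>\<^sub>F n in sequentially. n \<ge> 1" by (rule eventually_ge_at_top)
  have ratio: "\<forall>\<^sub>F n in sequentially. ennreal (1 - f n) = ratio n"
    using ev
  proof eventually_elim
    case (elim n)
    show ?case unfolding ratio_def f_def R_def m_def
      by (rule expected_face_ratio[symmetric]) (use elim assms in auto)
  qed
  have Nn: "(\<lambda>n. real (N n) / real n) \<longlonglongrightarrow> 1 / \<delta>"
    using tendsto_inverse[OF assms(8)] \<open>0 < \<delta>\<close> by (simp add: inverse_eq_divide)
  \<comment> \<open>The summand \<open>1 / real n\<close> stems from the \<open>- 1\<close> in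
    \<open>R\<close>; its limit stays visible as \<open>- 0\<close> in the facts below.\<close>
  have "(\<lambda>n. real (N n) / real n - real (k n) / real n - 1 / real n) \<longlonglongrightarrow> 1 / \<delta> - \<rho> - 0"
    by (intro tendsto_diff Nn assms(7) lim_1_over_n)
  moreover have "\<forall>\<^sub>F n in sequentially.
      real (N n) / real n - real (k n) / real n - 1 / real n = real (R n) / real n"
    using ev
  proof eventually_elim
    case (elim n)
    then have "k n + 1 \<le> N n" using assms(5,6)[of n] by simp
    then have "real (R n) = real (N n) - real (k n) - 1" by (simp add: R_def of_nat_diff)
    then show ?case by (simp add: diff_divide_distrib)
  qed
  ultimately have R: "(\<lambda>n. real (R n) / real n) \<longlonglongrightarrow> 1 / \<delta> - \<rho> - 0"
    by (rule Lim_transform_eventually)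
  have "(\<lambda>n. real (N n) / real n - 1) \<longlonglongrightarrow> 1 / \<delta> - 1"
    by (intro tendsto_diff Nn tendsto_const)
  moreover have "\<forall>\<^sub>F n in sequentially. real (N n) / real n - 1 = real (m n) / real n"
    using ev
  proof eventually_elim
    case (elim n)
    then have "n \<le> N n" using assms(6)[of n] by simp
    then show ?case using elim by (simp add: m_def of_nat_diff diff_divide_distrib)
  qed
  ultimately have m: "(\<lambda>n. real (m n) / real n) \<longlonglongrightarrow> 1 / \<delta> - 1"
    by (rule Lim_transform_eventually)
  have limit: "ratio \<longlonglongrightarrow> ennreal (1 - c)" if "f \<longlonglongrightarrow> c" for c
    using that by (intro Lim_transform_eventually[OF _ ratio] tendsto_ennrealI tendsto_diff tendsto_const)
  show ?thesis
  proof (intro conjI impI)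
    assume "\<rho> < rho_W_cube \<delta>"
    \<comment> \<open>Since \<open>\<rho>\<close> is positive, lying below the maximum means lying
      below \<open>2 - 1 / \<delta>\<close>, which rearranges to a cutoff below the mean.\<close>
    then have "1 / \<delta> - 1 < (1 / \<delta> - \<rho> - 0) / 2"
      using \<open>0 < \<rho>\<close> by (auto simp: rho_W_cube_def max_def split: if_splits)
    from limit[OF binomial_prefix_limit(1)[OF R m this, folded f_def]]
    show "ratio \<longlonglongrightarrow> 1" by simp
  next
    assume "rho_W_cube \<delta> < \<rho>"
    \<comment> \<open>Exceeding the maximum implies exceeding \<open>2 - 1 / \<delta>\<close>; the
      cutoff now lies above the mean, so almost all patterns are spoiled.\<close>
    then have "(1 / \<delta> - \<rho> - 0) / 2 < 1 / \<delta> - 1"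
      by (auto simp: rho_W_cube_def max_def split: if_splits)
    from limit[OF binomial_prefix_limit(2)[OF R m this, folded f_def]]
    show "ratio \<longlonglongrightarrow> 0" by simp
  qed
qed

end
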